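(* For $j\in\{4,5\}$ let $L_j=\log\left(\frac{j+\sqrt{j^2+4}}{2}\right)-j\cdot\frac{\log 2}{2}$, and let $\kappa_2=\frac{4L_5-5L_4}{L_5-L_4}$ (so $\kappa_2=4.401\ldots$). 1. Let $x\in(0,1)$ be irrational with regular continued fraction expansion $x=[0;a_1,\ldots,a_t,\ldots]$, and suppose that $$\liminf_{t\to\infty}\frac{a_1+\cdots+a_t}{t}>\kappa_2 .$$ Then the derivative $?'(x)$ exists and $?'(x)=0$. 2. For every $\varepsilon>0$ there exists a quadratic irrationality $x=[0;a_1,\ldots,a_t,\ldots]\in(0,1)$ such that the limit below exists and satisfies $$\lim_{t\to\infty}\frac{a_1+\cdots+a_t}{t}\ge \kappa_2-\varepsilon ,$$ and $?'(x)=+\infty$.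
   Context: The Minkowski question mark function $?:[0,1]\to[0,1]$ is defined as follows: $?(0)=0$, $?(1)=1$; if $?$ is already defined at successive Farey fractions $\frac pq<\frac{p'}{q'}$ (reduced fractions with $p'q-pq'=1$), then $?\left(\frac{p+p'}{q+q'}\right)=\frac12\left(?\left(\frac pq\right)+?\left(\frac{p'}{q'}\right)\right)$; at irrational $x$ it is defined by continuity. It is continuous and increasing, and for irrational $x=[0;a_1,a_2,\ldots]$ one has $?(x)=\sum_{n\ge1}\frac{(-1)^{n+1}}{2^{a_1+\cdots+a_n-1}}$. The notation $[0;a_1,a_2,\ldots]$ denotes the regular continued fraction $\cfrac{1}{a_1+\cfrac{1}{a_2+\cdots}}$ with partial quotients $a_i$ positive integers. The derivative $?'(x)=\lim_{\delta\to0}\frac{?(x+\delta)-?(x)}{\delta}$ is the two-sided limit, with the value $+\infty$ allowed. $\log$ is the natural logarithm. *)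

theory Defs
  imports "HOL-Analysis.Analysis"
begin

section \<open>The Minkowski question mark function\<close>

text \<open>
  Successive Farey fractions \<open>p/q < p'/q'\<close> in \<open>[0,1]\<close>, given by numerators and denominators.
  The determinant condition \<open>p' q - p q' = 1\<close> is written additively, because subtraction on
  natural numbers truncates; it forces both fractions to be reduced and \<open>p/q < p'/q' \<le> 1\<close>.
\<close>

definition farey_neighbours :: "nat \<Rightarrow> nat \<Rightarrow> nat \<Rightarrow> nat \<Rightarrow> bool" where
  "farey_neighbours p q p' q' \<longleftrightarrow> 0 < q \<and> 0 < q' \<and> p' \<le> q' \<and> p' * q = p * q' + 1"

definition is_question_mark :: "(real \<Rightarrow> real) \<Rightarrow> bool" where
  "is_question_mark f \<longleftrightarrow>
     f 0 = 0 \<and> f 1 = 1 \<and>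
     (\<forall>p q p' q'. farey_neighbours p q p' q' \<longrightarrow>
        f (real (p + p') / real (q + q')) =
          (f (real p / real q) + f (real p' / real q')) / 2) \<and>
     continuous_on {0..1} f"

text \<open>
  The conditions above determine a unique function on \<open>[0,1]\<close>; this is
  \<open>question_mark_ex1\<close> below. Outside \<open>[0,1]\<close> the value is set to \<open>0\<close>.
\<close>

definition question_mark :: "real \<Rightarrow> real" where
  "question_mark = (THE f. is_question_mark f \<and> (\<forall>x. x \<notin> {0..1} \<longrightarrow> f x = 0))"


subsection \<open>Existence\<close>

text \<open>
  The maps \<open>x \<mapsto> x / (1 - x)\<close> on \<open>[0, 1/2]\<close> and \<open>x \<mapsto> 2 - 1 / x\<close> on \<open>[1/2, 1]\<close> send
  Farey neighbours to Farey neighbours and mediants to mediants, so the function is the limit of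
  iterating the induced functional equation.
\<close>

primrec qm_approx :: "nat \<Rightarrow> real \<Rightarrow> real" where
  "qm_approx 0 x = x"
| "qm_approx (Suc n) x =
     (if x \<le> 1/2 then qm_approx n (x / (1 - x)) / 2 else 1/2 + qm_approx n (2 - 1 / x) / 2)"

lemma left_branch_mem: "0 \<le> x \<Longrightarrow> x \<le> 1/2 \<Longrightarrow> x / (1 - x) \<in> {0..1::real}"
  by (auto simp: field_simps)

lemma right_branch_mem: "1/2 \<le> x \<Longrightarrow> x \<le> 1 \<Longrightarrow> 2 - 1 / x \<in> {0..1::real}"
  by (auto simp: field_simps)

lemma qm_approx_0: "qm_approx n 0 = 0"
  by (induction n) auto

lemma qm_approx_1: "qm_approx n 1 = 1"
  by (induction n) auto

lemma qm_approx_diff: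
  "x \<in> {0..1} \<Longrightarrow> \<bar>qm_approx (Suc n) x - qm_approx n x\<bar> \<le> (1/2) ^ n"
proof (induction n arbitrary: x)
  case 0
  show ?case
  proof (cases "x \<le> 1/2")
    case True
    then have "x / (1 - x) \<in> {0..1}" using left_branch_mem 0 by auto
    moreover have "\<bar>y / 2 - x\<bar> \<le> 1" if "y \<in> {0..1}" for y using 0 that by auto
    ultimately have "\<bar>x / (1 - x) / 2 - x\<bar> \<le> 1" by blast
    then show ?thesis using True by (simp del: divide_divide_eq_left)
  next
    case False
    then have "2 - 1 / x \<in> {0..1}" using right_branch_mem[of x] 0 by auto
    moreover have "\<bar>1/2 + y / 2 - x\<bar> \<le> 1" if "y \<in> {0..1}" for y using 0 that by auto
    ultimately have "\<bar>1/2 + (2 - 1 / x) / 2 - x\<bar> \<le> 1" by blast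
    then show ?thesis using False by simp
  qed
next
  case (Suc n)
  have half: "\<bar>u / 2 - v / 2\<bar> \<le> (1/2) ^ Suc n" "\<bar>(1/2 + u / 2) - (1/2 + v / 2)\<bar> \<le> (1/2) ^ Suc n"
    if "\<bar>u - v\<bar> \<le> (1/2) ^ n" for u v :: real
    using that unfolding power_Suc by linarith+
  show ?case
  proof (cases "x \<le> 1/2")
    case True
    then have "x / (1 - x) \<in> {0..1}" using left_branch_mem Suc.prems by auto
    from half(1)[OF Suc.IH[OF this]] show ?thesis
      unfolding qm_approx.simps(2)[of "Suc n" x] qm_approx.simps(2)[of n x] by (simp only: True if_True if_False)
  next
    case False
    then have "2 - 1 / x \<in> {0..1}" using right_branch_mem[of x] Suc.prems by auto
    from half(2)[OF Suc.IH[OF this]] show ?thesis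
      unfolding qm_approx.simps(2)[of "Suc n" x] qm_approx.simps(2)[of n x] by (simp only: False if_True if_False)
  qed
qed

lemma continuous_qm_approx: "continuous_on {0..1} (qm_approx n)"
proof (induction n)
  case 0
  then show ?case by (simp add: continuous_on_id)
next
  case (Suc n)
  have L: "continuous_on {0..1/2} (\<lambda>x. qm_approx n (x / (1 - x)) / 2)"
    by (intro continuous_intros continuous_on_compose2[OF Suc])
       (use left_branch_mem in auto)
  have R: "continuous_on {1/2..1} (\<lambda>x. 1/2 + qm_approx n (2 - 1 / x) / 2)"
    by (intro continuous_intros continuous_on_compose2[OF Suc])
       (use right_branch_mem in auto)
  have "continuous_on ({0..1/2} \<union> {1/2..1})
          (\<lambda>x. if x \<le> 1/2 then qm_approx n (x / (1 - x)) / 2 else 1/2 + qm_approx n (2 - 1 / x) / 2)"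
  proof (rule continuous_on_If)
    fix x :: real assume "x \<in> {1/2..1}" "x \<le> 1/2"
    then have "x = 1/2" by auto
    show "qm_approx n (x / (1 - x)) / 2 = 1/2 + qm_approx n (2 - 1 / x) / 2"
      unfolding \<open>x = 1/2\<close> by (simp add: qm_approx_0 qm_approx_1)
  next
    fix x :: real assume "x \<in> {0..1/2}" "\<not> x \<le> 1/2"
    then show "qm_approx n (x / (1 - x)) / 2 = 1/2 + qm_approx n (2 - 1 / x) / 2" by simp
  qed (use L R in auto)
  moreover have "{0..1/2} \<union> {1/2..1} = {0..1::real}" by auto
  ultimately show ?case by simp
qed

definition qm_lim :: "real \<Rightarrow> real" where
  "qm_lim x = x + (\<Sum>n. qm_approx (Suc n) x - qm_approx n x)"

lemma uniform_limit_qm_approx: "uniform_limit {0..1} qm_approx qm_lim sequentially"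
proof -
  have *: "uniform_limit {0..1} (\<lambda>n x. \<Sum>i<n. qm_approx (Suc i) x - qm_approx i x)
          (\<lambda>x. \<Sum>n. qm_approx (Suc n) x - qm_approx n x) sequentially"
    by (rule Weierstrass_m_test[where M = "\<lambda>n. (1/2) ^ n"])
       (use qm_approx_diff in \<open>auto simp del: qm_approx.simps\<close>)
  have "uniform_limit {0..1} (\<lambda>n x. x + (\<Sum>i<n. qm_approx (Suc i) x - qm_approx i x))
          (\<lambda>x. x + (\<Sum>n. qm_approx (Suc n) x - qm_approx n x)) sequentially"
    by (rule uniform_limit_add[OF uniform_limit_const *])
  moreover have "x + (\<Sum>i<n. qm_approx (Suc i) x - qm_approx i x) = qm_approx n x" for n x
    by (subst sum_lessThan_telescope) simp
  ultimately show ?thesis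
    unfolding qm_lim_def[abs_def] by simp
qed

lemma continuous_qm_lim: "continuous_on {0..1} qm_lim"
  by (rule uniform_limit_theorem[OF _ uniform_limit_qm_approx])
     (auto intro: always_eventually continuous_qm_approx)

lemma qm_approx_LIMSEQ: "x \<in> {0..1} \<Longrightarrow> (\<lambda>n. qm_approx n x) \<longlonglongrightarrow> qm_lim x"
  using uniform_limit_qm_approx by (rule tendsto_uniform_limitI)

lemma qm_lim_0: "qm_lim 0 = 0" and qm_lim_1: "qm_lim 1 = 1"
  using qm_approx_LIMSEQ[of 0] qm_approx_LIMSEQ[of 1]
  by (auto simp: qm_approx_0 qm_approx_1 LIMSEQ_const_iff)

lemma qm_lim_left:
  assumes "0 \<le> x" "x \<le> 1/2"
  shows "qm_lim x = qm_lim (x / (1 - x)) / 2"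
proof (rule LIMSEQ_unique)
  show "(\<lambda>n. qm_approx (Suc n) x) \<longlonglongrightarrow> qm_lim x"
    using LIMSEQ_Suc[OF qm_approx_LIMSEQ[of x]] assms by auto
  have "(\<lambda>n. qm_approx n (x / (1 - x)) / 2) \<longlonglongrightarrow> qm_lim (x / (1 - x)) / 2"
    by (intro tendsto_intros qm_approx_LIMSEQ left_branch_mem assms) auto
  then show "(\<lambda>n. qm_approx (Suc n) x) \<longlonglongrightarrow> qm_lim (x / (1 - x)) / 2"
    using assms by simp
qed

lemma qm_lim_right:
  assumes "1/2 \<le> x" "x \<le> 1"
  shows "qm_lim x = 1/2 + qm_lim (2 - 1 / x) / 2"
proof (cases "x = 1/2")
  case True
  show ?thesis unfolding True using qm_lim_left[of "1/2"] by (simp add: qm_lim_0 qm_lim_1)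
next
  case False
  show ?thesis
  proof (rule LIMSEQ_unique)
    show "(\<lambda>n. qm_approx (Suc n) x) \<longlonglongrightarrow> qm_lim x"
      using LIMSEQ_Suc[OF qm_approx_LIMSEQ[of x]] assms by auto
    have "(\<lambda>n. 1/2 + qm_approx n (2 - 1 / x) / 2) \<longlonglongrightarrow> 1/2 + qm_lim (2 - 1 / x) / 2"
      by (intro tendsto_intros qm_approx_LIMSEQ right_branch_mem assms) auto
    then show "(\<lambda>n. qm_approx (Suc n) x) \<longlonglongrightarrow> 1/2 + qm_lim (2 - 1 / x) / 2"
      using assms False by simp
  qed
qed

lemma qm_lim_mediant:
  assumes "farey_neighbours p q p' q'"
  shows "qm_lim (real (p + p') / real (q + q')) =
           (qm_lim (real p / real q) + qm_lim (real p' / real q')) / 2"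
  using assms
proof (induction "q + q'" arbitrary: p q p' q' rule: less_induct)
  case less
  then have F: "0 < q" "0 < q'" "p' \<le> q'" "p' * q = p * q' + 1"
    by (auto simp: farey_neighbours_def)
  have "p * q' < q * q'" using F by (metis add.commute less_eq_Suc_le mult.commute mult_le_mono1 plus_1_eq_Suc)
  then have pq: "p < q" by simp
  have p': "0 < p'" using F by (cases p') auto
  consider "2 * p' \<le> q'" | "q \<le> 2 * p" | "2 * p + 1 \<le> q" "q' + 1 \<le> 2 * p'" by linarith
  then show ?case
  proof cases
    case 1
    define r r' where "r = q - p" and "r' = q' - p'"
    have q: "q = r + p" "q' = r' + p'" "0 < r" "0 < r'" "p' \<le> r'"
      using pq F 1 p' by (auto simp: r_def r'_def)
    have N: "farey_neighbours p r p' r'"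
      using F q by (auto simp: farey_neighbours_def algebra_simps)
    have IH: "qm_lim (real (p + p') / real (r + r')) =
           (qm_lim (real p / real r) + qm_lim (real p' / real r')) / 2"
      by (rule less.hyps[OF _ N]) (use q p' in simp)
    have "p * r' < r * p'" using N by (simp add: farey_neighbours_def mult.commute)
    also have "r * p' \<le> r * r'" using q by simp
    finally have pr: "p \<le> r" by simp
    have red: "qm_lim (real a / real (b + a)) = qm_lim (real a / real b) / 2"
      if "0 < b" "a \<le> b" for a b :: nat
    proof -
      have "1 - real a / real (b + a) = real b / real (b + a)"
        using that by (simp add: field_simps)
      then have "real a / real (b + a) / (1 - real a / real (b + a)) = real a / real b"
        using that by simp
      then show ?thesis
        using qm_lim_left[of "real a / real (b + a)"] that
        by (simp only:) (simp add: field_simps)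
    qed
    show ?thesis
      using IH red[of r p] red[of r' p'] red[of "r + r'" "p + p'"] q pr
      by (simp add: add_ac)
  next
    case 2
    define s s' where "s = 2 * p - q" and "s' = 2 * p' - q'"
    have "q * q' \<le> 2 * (p * q')" using mult_le_mono1[OF 2, of q'] by simp
    then have "q * q' < 2 * (p' * q)" using F(4) by linarith
    then have "q' < 2 * p'" by (simp add: mult.commute mult.left_commute)
    then have q: "q + s = 2 * p" "q' + s' = 2 * p'" "0 < p" "s' \<le> p'"
      using 2 F by (auto simp: s_def s'_def)
    then have qi: "int q = 2 * int p - int s" "int q' = 2 * int p' - int s'" by linarith+
    have "int p' * int q = int p * int q' + 1" using F(4) by (metis of_nat_1 of_nat_add of_nat_mult)
    then have "int s' * int p = int s * int p' + 1"
      unfolding qi by (simp add: algebra_simps)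
    then have d: "s' * p = s * p' + 1" by (metis of_nat_1 of_nat_add of_nat_eq_iff of_nat_mult)
    have N: "farey_neighbours s p s' p'"
      using q p' d by (auto simp: farey_neighbours_def)
    have IH: "qm_lim (real (s + s') / real (p + p')) =
           (qm_lim (real s / real p) + qm_lim (real s' / real p')) / 2"
      by (rule less.hyps[OF _ N]) (use pq F in simp)
    have red: "qm_lim (real a / real b) = 1/2 + qm_lim (real c / real a) / 2"
      if "b + c = 2 * a" "0 < a" "a \<le> b" for a b c :: nat
    proof -
      have b: "real b = 2 * real a - real c" using that by linarith
      have "2 - 1 / (real a / real b) = real c / real a"
        using that by (simp add: field_simps b)
      then show ?thesis
        using qm_lim_right[of "real a / real b"] that by (simp only:) simp
    qed
    show ?thesis
      using IH red[of q s p] red[of q' s' p'] red[of "q + q'" "s + s'" "p + p'"] q pq p' F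
      by (simp add: add_ac)
  next
    case 3
    have "(q' + 1) * q \<le> 2 * (p' * q)" using mult_le_mono1[OF 3(2), of q] by simp
    moreover have "2 * (p * q') + q' \<le> q * q'" using mult_le_mono1[OF 3(1), of q'] by simp
    ultimately have "q + q' \<le> 2" using F(4) by (simp add: algebra_simps)
    then have "q = 1" "q' = 1" using F by auto
    then have "p = 0" "p' = 1" using pq F p' by auto
    then show ?thesis
      using \<open>q = 1\<close> \<open>q' = 1\<close> qm_lim_left[of "1/2"] by (simp add: qm_lim_0 qm_lim_1)
  qed
qed

lemma is_question_mark_qm_lim: "is_question_mark qm_lim"
  unfolding is_question_mark_def
  using qm_lim_0 qm_lim_1 qm_lim_mediant continuous_qm_lim by blast


subsection \<open>Uniqueness\<close>

lemma is_question_markD: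
  assumes "is_question_mark f"
  shows "f 0 = 0" "f 1 = 1"
    and "farey_neighbours p q p' q' \<Longrightarrow>
      f (real (p + p') / real (q + q')) = (f (real p / real q) + f (real p' / real q')) / 2"
    and "continuous_on {0..1} f"
  using assms unfolding is_question_mark_def by blast+

lemma mediant_decomposition:
  assumes "coprime a b" "a < b" "2 \<le> b"
  obtains p q p' q' where "farey_neighbours p q p' q'" "a = p + p'" "b = q + q'" "p \<le> q"
proof -
  obtain q0 y where q0: "a * q0 = b * y + 1"
    using coprime_bezout_strong[of a b] assms by auto
  define q where "q = q0 mod b"
  have "(a * q) mod b = (a * q0) mod b" by (simp add: q_def mod_mult_right_eq)
  also have "\<dots> = 1" unfolding q0 using assms by (simp only: mod_mult_self4) simp
  finally have "(a * q) mod b = 1" .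
  then obtain p where p: "a * q = b * p + 1" by (metis mult_div_mod_eq)
  have qb: "q < b" using assms by (simp add: q_def)
  have q: "0 < q" using p by (cases q) auto
  have "b * p < b * a" using p qb
    by (metis add.commute less_eq_Suc_le mult.commute mult_le_mono1 nat_less_le plus_1_eq_Suc)
  then have pa: "p < a" by simp
  define p' q' where "p' = a - p" and "q' = b - q"
  have ab: "a = p + p'" "b = q + q'" using pa qb by (auto simp: p'_def q'_def)
  have d: "p' * q = p * q' + 1" using p unfolding ab by (simp add: algebra_simps)
  have q': "0 < q'" using qb by (simp add: q'_def)
  have p'q': "p' \<le> q'"
  proof (rule ccontr)
    assume "\<not> p' \<le> q'"
    then have "q' + 1 \<le> p'" "p + 1 \<le> q" using ab assms by auto
    have "(q' + 1) * (p + 1) \<le> p' * q"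
      using \<open>q' + 1 \<le> p'\<close> \<open>p + 1 \<le> q\<close> by (rule mult_le_mono)
    with d q' show False by (simp add: algebra_simps)
  qed
  have "p * q' < q * q'"
    using d p'q' by (metis add.commute less_eq_Suc_le mult.commute mult_le_mono1 plus_1_eq_Suc)
  then have "p \<le> q" by simp
  with that[of p q p' q'] show ?thesis
    using ab d q q' p'q' by (auto simp: farey_neighbours_def)
qed

lemma farey_neighbours_coprime:
  assumes "farey_neighbours p q p' q'"
  shows "coprime p q" "coprime p' q'"
proof -
  have d: "p' * q = p * q' + 1" using assms by (simp add: farey_neighbours_def)
  show "coprime p q"
  proof (rule coprimeI)
    fix c assume "c dvd p" "c dvd q"
    then have "c dvd p * q' + 1" "c dvd p * q'" by (auto simp only: d[symmetric] dvd_mult dvd_mult2)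
    then show "is_unit c" by (metis dvd_add_right_iff)
  qed
  show "coprime p' q'"
  proof (rule coprimeI)
    fix c assume "c dvd p'" "c dvd q'"
    then have "c dvd p * q' + 1" "c dvd p * q'" by (auto simp only: d[symmetric] dvd_mult dvd_mult2)
    then show "is_unit c" by (metis dvd_add_right_iff)
  qed
qed

lemma is_question_mark_unique_coprime:
  assumes f: "is_question_mark f" and g: "is_question_mark g"
  shows "coprime a b \<Longrightarrow> a \<le> b \<Longrightarrow> 0 < b \<Longrightarrow> f (real a / real b) = g (real a / real b)"
proof (induction b arbitrary: a rule: less_induct)
  case (less b)
  show ?case
  proof (cases "b = 1")
    case True
    then have "a = 0 \<or> a = 1" using less.prems by auto
    moreover have "f 0 = g 0" "f 1 = g 1" using is_question_markD(1,2)[OF f] is_question_markD(1,2)[OF g]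
      by auto
    ultimately show ?thesis using True by auto
  next
    case False
    then have "2 \<le> b" using less.prems by linarith
    moreover have "a \<noteq> b" using less.prems False by auto
    ultimately have "2 \<le> b" "a < b" using less.prems by linarith+
    then obtain p q p' q' where
      N: "farey_neighbours p q p' q'" and ab: "a = p + p'" "b = q + q'" and pq: "p \<le> q"
      using mediant_decomposition[OF less.prems(1)] by blast
    have "f (real p / real q) = g (real p / real q)"
         "f (real p' / real q') = g (real p' / real q')"
      using less.IH[of q p] less.IH[of q' p'] N ab pq farey_neighbours_coprime[OF N]
      by (auto simp: farey_neighbours_def)
    then show ?thesis
      unfolding ab is_question_markD(3)[OF f N] is_question_markD(3)[OF g N] by simp
  qed
qed

lemma is_question_mark_unique:
  assumes f: "is_question_mark f" and g: "is_question_mark g" and x: "x \<in> {0..1}"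
  shows "f x = g x"
proof -
  have rat: "f y = g y" if "y \<in> {0<..<1} \<inter> \<rat>" for y
  proof -
    from that have "y \<in> \<rat>" by simp
    then obtain m n :: nat where mn: "n \<noteq> 0" "\<bar>y\<bar> = real m / real n" "coprime m n"
      by (rule Rats_abs_nat_div_natE)
    with that have y: "y = real m / real n" by simp
    with that mn have "m \<le> n" by (auto simp: field_simps)
    then show ?thesis using is_question_mark_unique_coprime[OF f g] mn y by simp
  qed
  have cl: "closure ({0<..<1} \<inter> \<rat>) = {0..1::real}"
    using closure_open_Int_superset[of "{0<..<1::real}" \<rat>] by (simp add: Rats_closure_real)
  have "continuous_on (closure ({0<..<1} \<inter> \<rat>)) (\<lambda>y. f y - g y)"
    unfolding cl by (intro continuous_on_diff) (rule is_question_markD(4)[OF f] is_question_markD(4)[OF g])+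
  then have "f x - g x = 0"
    by (rule continuous_constant_on_closure) (use rat x cl in auto)
  then show ?thesis by simp
qed

lemma question_mark_ex1: "\<exists>!f. is_question_mark f \<and> (\<forall>x. x \<notin> {0..1} \<longrightarrow> f x = 0)"
proof (rule ex1I)
  let ?f = "\<lambda>x. if x \<in> {0..1} then qm_lim x else 0"
  have "continuous_on {0..1} ?f"
    using continuous_qm_lim by (subst continuous_on_cong[OF refl, where g = qm_lim]) auto
  moreover have "real (p + p') / real (q + q') \<in> {0..1} \<and> real p / real q \<in> {0..1} \<and>
      real p' / real q' \<in> {0..1}" if "farey_neighbours p q p' q'" for p q p' q'
  proof -
    have F: "0 < q" "0 < q'" "p' \<le> q'" "p' * q = p * q' + 1"
      using that by (auto simp: farey_neighbours_def)
    have "p * q' < q * q'" using F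
      by (metis add.commute less_eq_Suc_le mult.commute mult_le_mono1 plus_1_eq_Suc)
    then have "p < q" by simp
    then show ?thesis using F by simp
  qed
  ultimately have "is_question_mark ?f"
    using is_question_mark_qm_lim unfolding is_question_mark_def by simp
  then show "is_question_mark ?f \<and> (\<forall>x. x \<notin> {0..1} \<longrightarrow> ?f x = 0)" by simp
  fix g assume g: "is_question_mark g \<and> (\<forall>x. x \<notin> {0..1} \<longrightarrow> g x = 0)"
  show "g = ?f"
    using g is_question_mark_unique[OF _ is_question_mark_qm_lim, of g] by fastforce
qed

lemma is_question_mark_question_mark: "is_question_mark question_mark"
  using theI'[OF question_mark_ex1] unfolding question_mark_def by blast


section \<open>Regular continued fractions\<close>

text \<open>
  \<open>cf_convergent a t\<close> is \<open>[0; a 1, ..., a t]\<close>. Partial quotients are indexed from 1;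
  \<open>a 0\<close> is not used.
\<close>

primrec cf_convergent :: "(nat \<Rightarrow> nat) \<Rightarrow> nat \<Rightarrow> real" where
  "cf_convergent a 0 = 0"
| "cf_convergent a (Suc t) = 1 / (real (a 1) + cf_convergent (\<lambda>i. a (Suc i)) t)"

definition is_cf_expansion :: "(nat \<Rightarrow> nat) \<Rightarrow> real \<Rightarrow> bool" where
  "is_cf_expansion a x \<longleftrightarrow> (\<forall>i\<ge>1. a i > 0) \<and> cf_convergent a \<longlonglongrightarrow> x"

definition mean_partial_quotient :: "(nat \<Rightarrow> nat) \<Rightarrow> nat \<Rightarrow> real" where
  "mean_partial_quotient a t = (\<Sum>i=1..t. real (a i)) / real t"

definition quadratic_irrational :: "real \<Rightarrow> bool" where
  "quadratic_irrational x \<longleftrightarrow>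
     x \<notin> \<rat> \<and> (\<exists>a b c :: int. a \<noteq> 0 \<and> of_int a * x\<^sup>2 + of_int b * x + of_int c = 0)"


section \<open>The constant \<open>\<kappa>\<^sub>2\<close>\<close>

definition L_const :: "nat \<Rightarrow> real" where
  "L_const j = ln ((real j + sqrt ((real j)\<^sup>2 + 4)) / 2) - real j * (ln 2 / 2)"

definition kappa2 :: real where
  "kappa2 = (4 * L_const 5 - 5 * L_const 4) / (L_const 5 - L_const 4)"

end

theory Submission
  imports Defs
begin

text \<open>
  On a cylinder of the continued fraction with denominators \<open>q\<^sub>t, q\<^sub>t\<^sub>-\<^sub>1\<close> and digit sum \<open>S\<^sub>t\<close> the
  question mark function is an affinely rescaled copy of itself in the Gauss map coordinate. If \<open>t\<close>
  is the last index for which \<open>y\<close> lies in the cylinder of \<open>x\<close>, the difference quotient at \<open>x, y\<close>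
  is therefore \<open>q\<^sub>t\<^sup>2 / 2 ^ S\<^sub>t\<close> times a factor that is bounded above absolutely, and bounded below if
  the digits of \<open>x\<close> are 4 and 5. What remains is the growth of \<open>q\<^sub>t\<close>. The upper bound
  \<open>q\<^sub>t \<le> exp (\<alpha> S\<^sub>t + \<beta> t)\<close>, with \<open>\<alpha>\<close> and \<open>\<beta>\<close> chosen to be sharp for the constant sequences 4
  and 5, follows from an extremal norm: the maximum of the two leading left eigenvectors of the
  matrices of the digits 4 and 5. In the opposite direction, periodic words consisting of a long
  block of digits 4 and a long block of digits 5 attain this growth up to a constant per period.
\<close>

section \<open>The question mark function under the Gauss map\<close>

lemma question_mark_eq_qm_lim: "x \<in> {0..1} \<Longrightarrow> question_mark x = qm_lim x"
  using is_question_mark_unique[OF is_question_mark_question_mark is_question_mark_qm_lim] .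

text \<open>Both branches of the recursion are increasing, and the left one takes values up to 1/2
  while the right one starts from 1/2.\<close>

lemma qm_approx_mono:
  assumes "0 \<le> x" "x \<le> y" "y \<le> 1"
  shows "qm_approx n x \<le> qm_approx n y"
  using assms
proof (induction n arbitrary: x y)
  case 0
  then show ?case by simp
next
  case (Suc n)
  have bounds: "0 \<le> qm_approx n z \<and> qm_approx n z \<le> 1" if "z \<in> {0..1}" for z
    using Suc.IH[of 0 z] Suc.IH[of z 1] that by (simp add: qm_approx_0 qm_approx_1)
  consider "y \<le> 1/2" | "x \<le> 1/2" "1/2 < y" | "1/2 < x" by linarith
  then show ?case
  proof cases
    case 1
    then have "qm_approx n (x / (1 - x)) \<le> qm_approx n (y / (1 - y))"
      using Suc.prems by (intro Suc.IH frac_le) (auto simp: field_simps)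
    then show ?thesis using 1 Suc.prems by simp
  next
    case 2
    have "qm_approx n (x / (1 - x)) \<le> 1" "0 \<le> qm_approx n (2 - 1 / y)"
      using bounds left_branch_mem[of x] right_branch_mem[of y] 2 Suc.prems by auto
    then show ?thesis using 2 Suc.prems by simp
  next
    case 3
    then have "qm_approx n (2 - 1 / x) \<le> qm_approx n (2 - 1 / y)"
      using Suc.prems by (intro Suc.IH) (auto simp: field_simps)
    then show ?thesis using 3 Suc.prems by simp
  qed
qed

text \<open>The reflection at 1/2 exchanges the two branches, so points below 1/2 suffice.\<close>

lemma qm_approx_reflect: "x \<in> {0..1} \<Longrightarrow> qm_approx n (1 - x) = 1 - qm_approx n x"
proof (induction n arbitrary: x)
  case 0
  then show ?case by simp
next
  case (Suc n)
  have low: "qm_approx (Suc n) (1 - y) = 1 - qm_approx (Suc n) y" if "0 \<le> y" "y < 1/2" for y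
  proof -
    have "2 - 1 / (1 - y) = 1 - y / (1 - y)" using that by (simp add: field_simps)
    then have "qm_approx n (2 - 1 / (1 - y)) = 1 - qm_approx n (y / (1 - y))"
      using Suc.IH[OF left_branch_mem[of y]] that by (simp only:)
    then show ?thesis using that by (simp only: qm_approx.simps) (simp add: diff_divide_distrib)
  qed
  consider "x < 1/2" | "x = 1/2" | "1 - x < 1/2" by linarith
  then show ?case
  proof cases
    case 1
    then show ?thesis using low[of x] Suc.prems by auto
  next
    case 2
    show ?thesis unfolding 2 by (simp add: qm_approx_1)
  next
    case 3
    then show ?thesis using low[of "1 - x"] Suc.prems by (auto simp del: qm_approx.simps)
  qed
qed

lemma question_mark_mono:
  assumes "0 \<le> x" "x \<le> y" "y \<le> 1"
  shows "question_mark x \<le> question_mark y"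
proof -
  have "qm_lim x \<le> qm_lim y"
    by (rule LIMSEQ_le[OF qm_approx_LIMSEQ qm_approx_LIMSEQ]) (use assms qm_approx_mono in auto)
  then show ?thesis using assms by (simp add: question_mark_eq_qm_lim)
qed

lemma question_mark_reflect:
  assumes "x \<in> {0..1}"
  shows "question_mark (1 - x) = 1 - question_mark x"
proof -
  have "(\<lambda>n. qm_approx n (1 - x)) \<longlonglongrightarrow> 1 - qm_lim x"
    using assms by (auto simp: qm_approx_reflect intro!: tendsto_intros qm_approx_LIMSEQ)
  then have "qm_lim (1 - x) = 1 - qm_lim x"
    using LIMSEQ_unique qm_approx_LIMSEQ[of "1 - x"] assms by auto
  then show ?thesis using assms by (simp add: question_mark_eq_qm_lim)
qed

lemma question_mark_0: "question_mark 0 = 0" and question_mark_1: "question_mark 1 = 1"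
  by (simp_all add: question_mark_eq_qm_lim qm_lim_0 qm_lim_1)

lemma question_mark_bounds:
  assumes "x \<in> {0..1}"
  shows "0 \<le> question_mark x" "question_mark x \<le> 1"
  using question_mark_mono[of 0 x] question_mark_mono[of x 1] assms
  by (auto simp: question_mark_0 question_mark_1)

text \<open>The functional equation for one step of the Gauss map. The right branch followed by the
  reflection gives \<open>n = 1\<close>; the left branch sends \<open>1 / (n + 1 + y)\<close> to
  \<open>1 / (n + y)\<close> and halves the value.\<close>

lemma question_mark_inverse_add:
  assumes "y \<in> {0..1}" "0 < n"
  shows "question_mark (1 / (real n + y)) = 2 * (1/2) ^ n - (1/2) ^ n * question_mark y"
  using assms(2)
proof (induction n rule: nat_induct_non_zero)
  case 1
  have y: "0 \<le> y" "y \<le> 1" using assms by auto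
  have "question_mark (1 / (1 + y)) = 1/2 + question_mark (1 - y) / 2"
    using qm_lim_right[of "1 / (1 + y)"] y by (simp add: question_mark_eq_qm_lim field_simps)
  then show ?case using assms by (simp add: question_mark_reflect diff_divide_distrib)
next
  case (Suc n)
  let ?w = "1 / (real n + y)"
  have y: "0 \<le> y" "y \<le> 1" "1 \<le> real n" using assms Suc by auto
  have w: "?w \<in> {0..1}" using y by (auto simp: field_simps)
  have "1 / (real (Suc n) + y) / (1 - 1 / (real (Suc n) + y)) = ?w"
    using y by (simp add: field_simps)
  then have "qm_lim (1 / (real (Suc n) + y)) = qm_lim ?w / 2"
    using qm_lim_left[of "1 / (real (Suc n) + y)"] y by (simp add: field_simps)
  moreover have "1 / (real (Suc n) + y) \<in> {0..1}" using y by (auto simp: field_simps)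
  ultimately have "question_mark (1 / (real (Suc n) + y)) = question_mark ?w / 2"
    using w by (simp only: question_mark_eq_qm_lim)
  then show ?case unfolding Suc.IH by (simp add: diff_divide_distrib)
qed

lemma question_mark_inverse: "0 < n \<Longrightarrow> question_mark (1 / real n) = 2 * (1/2) ^ n"
  using question_mark_inverse_add[of 0 n] by (simp add: question_mark_0)


section \<open>Difference quotients at unit fractions\<close>

text \<open>If \<open>x\<close> lies between \<open>1 / (n + 1)\<close> and \<open>1 / n\<close>,
  monotonicity bounds the value by \<open>2 * (1/2) ^ n\<close>, and
  \<open>n + 1 \<le> 2 ^ n\<close>. Reflection turns this slope bound at 0 into one at 1.\<close>

lemma question_mark_le:
  assumes "0 \<le> x" "x \<le> 1"
  shows "question_mark x \<le> 2 * x"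
proof (cases "x = 0")
  case True
  then show ?thesis by (simp add: question_mark_0)
next
  case False
  define n where "n = nat \<lfloor>1 / x\<rfloor>"
  have "1 \<le> 1 / x" using assms False by simp
  then have n: "real n \<le> 1 / x" "1 / x < real n + 1" "0 < n"
    unfolding n_def by linarith+
  have "x \<le> 1 / real n" using n assms False by (simp add: field_simps)
  then have "question_mark x \<le> 2 * (1/2) ^ n"
    using question_mark_mono[of x "1 / real n"] n assms by (simp add: question_mark_inverse)
  also have "\<dots> \<le> 2 * (1 / (real n + 1))"
  proof -
    have "n < 2 ^ n" by (rule less_exp)
    then have "real (Suc n) \<le> real (2 ^ n)" by (simp only: of_nat_le_iff Suc_le_eq)
    then have "real n + 1 \<le> 2 ^ n" by simp
    then have "1 / (2 ^ n) \<le> 1 / (real n + 1)" by (intro frac_le) auto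
    then show ?thesis by (simp add: power_divide)
  qed
  also have "\<dots> \<le> 2 * x" using n assms False by (simp add: field_simps)
  finally show ?thesis .
qed

lemma one_minus_question_mark_le:
  assumes "0 \<le> x" "x \<le> 1"
  shows "1 - question_mark x \<le> 2 * (1 - x)"
  using question_mark_le[of "1 - x"] question_mark_reflect[of x] assms by auto

lemma sq_le_two_power: "real n * real n \<le> 9/8 * 2 ^ n"
proof -
  have "real n * real n \<le> 2 ^ n" if "4 \<le> n" for n
    using that
  proof (induction n rule: dec_induct)
    case base
    show ?case by simp
  next
    case (step n)
    have "4 * real n \<le> real n * real n" using step by simp
    moreover have "real (Suc n) * real (Suc n) = real n * real n + 2 * real n + 1"
      by (simp add: algebra_simps)
    moreover have "4 \<le> real n" using step by simp
    ultimately have "real (Suc n) * real (Suc n) \<le> 2 * (real n * real n)" by linarith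
    then show ?case using step.IH by simp
  qed
  moreover have "real n * real n \<le> 9/8 * 2 ^ n" if "n < 4"
  proof -
    \<comment> \<open>The constant 9/8 is attained at \<open>n = 3\<close>.\<close>
    have "n = 0 \<or> n = 1 \<or> n = 2 \<or> n = 3" using that by auto
    then show ?thesis by auto
  qed
  moreover have "(2::real) ^ n \<le> 9/8 * 2 ^ n" by simp
  ultimately show ?thesis by (meson leI order_trans)
qed

lemma cell_rem:
  assumes "0 < n" "1 / (real n + 1) \<le> z" "z \<le> 1 / real n"
  shows "1 / z - real n \<in> {0..1}" "0 < z"
proof -
  have "0 < 1 / (real n + 1)" by simp
  then show "0 < z" using assms(2) by linarith
  then show "1 / z - real n \<in> {0..1}" using assms by (auto simp: field_simps)
qed

text \<open>In the cell adjacent to \<open>1 / n\<close> the functional equation reduces the claim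
  to the slope at 0, with a distortion factor of order \<open>n\<^sup>2 / 2 ^ n\<close>. Further
  left, the whole value at \<open>1 / n\<close> is already small compared with the cell width
  \<open>1 / (n * (n + 1))\<close>.\<close>

lemma question_mark_diff_below_inverse:
  assumes "0 < n" "0 \<le> z" "z \<le> 1 / real n"
  shows "question_mark (1 / real n) - question_mark z \<le> 5 * (1 / real n - z)"
proof -
  have n: "1 \<le> real n" using assms by simp
  have K: "(1/2) ^ n * (real n * (real n + 1)) \<le> 9/4"
  proof -
    have "real n * (real n + 1) \<le> 2 * (real n * real n)" using n by (simp add: algebra_simps)
    also have "\<dots> \<le> 9/4 * 2 ^ n" using sq_le_two_power[of n] by simp
    finally show ?thesis by (simp add: field_simps power_divide)
  qed
  show ?thesis
  proof (cases "1 / (real n + 1) \<le> z")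
    case True
    define y where "y = 1 / z - real n"
    have z0: "0 < z" and y: "y \<in> {0..1}" using cell_rem[OF assms(1) True assms(3)] y_def by auto
    have z: "z = 1 / (real n + y)" using z0 by (simp add: y_def)
    have "1 / real n - z = y / (real n * (real n + y))"
      using n y by (subst z) (simp add: field_simps)
    then have ye: "y = (1 / real n - z) * (real n * (real n + y))" using n y by simp
    have "question_mark (1 / real n) - question_mark z = (1/2) ^ n * question_mark y"
      using y assms by (simp add: z question_mark_inverse_add question_mark_inverse)
    also have "\<dots> \<le> (1/2) ^ n * (2 * y)"
      using y question_mark_le[of y] by (intro mult_left_mono) auto
    also have "\<dots> \<le> (1/2) ^ n * (2 * ((1 / real n - z) * (real n * (real n + 1))))"
      using y n assms by (subst ye) (intro mult_left_mono, auto)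
    also have "\<dots> = 2 * (1 / real n - z) * ((1/2) ^ n * (real n * (real n + 1)))"
      by simp
    also have "\<dots> \<le> 2 * (1 / real n - z) * (9/4)"
      using assms by (intro mult_left_mono K) auto
    also have "\<dots> \<le> 5 * (1 / real n - z)" using assms by (simp add: field_simps)
    finally show ?thesis .
  next
    case False
    have "1 / real n \<le> 1" using n by simp
    then have z1: "z \<in> {0..1}" using assms(2) order_trans[OF assms(3)] by simp
    have "question_mark (1 / real n) - question_mark z \<le> 2 * (1/2) ^ n"
      using question_mark_bounds(1)[OF z1] by (simp only: question_mark_inverse[OF assms(1)])
    also have "\<dots> = 2 * ((1/2) ^ n * (real n * (real n + 1))) * (1 / (real n * (real n + 1)))"
      using n by simp
    also have "\<dots> \<le> 5 * (1 / (real n * (real n + 1)))"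
      using K n by (intro mult_right_mono) auto
    also have "1 / (real n * (real n + 1)) = 1 / real n - 1 / (real n + 1)"
      using n by (simp add: field_simps)
    also have "5 * (1 / real n - 1 / (real n + 1)) \<le> 5 * (1 / real n - z)" using False by simp
    finally show ?thesis .
  qed
qed

text \<open>In the adjacent cell the functional equation reduces the claim to the slope at 1. Beyond
  that cell the estimates from \<open>1 / (n + 1)\<close> to \<open>1 / n\<close> and from
  \<open>1 / n\<close> to \<open>z\<close> add up with the same constant, hence the
  induction.\<close>

lemma question_mark_diff_above_inverse:
  assumes "0 < n" "1 / real n \<le> z" "z \<le> 1"
  shows "question_mark z - question_mark (1 / real n) \<le> 5 * (z - 1 / real n)"
  using assms
proof (induction n arbitrary: z rule: nat_induct_non_zero)
  case 1
  then show ?case by simp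
next
  case (Suc n)
  have n: "1 \<le> real n" using Suc.hyps by simp
  have Sn: "real (Suc n) = real n + 1" by simp
  have near: "question_mark z - question_mark (1 / real (Suc n)) \<le> 5 * (z - 1 / real (Suc n))"
    if z: "1 / real (Suc n) \<le> z" "z \<le> 1 / real n" for z
  proof -
    define y where "y = 1 / z - real n"
    have z0: "0 < z" and y: "y \<in> {0..1}"
      using cell_rem[OF Suc.hyps, of z] z y_def by (auto simp: add.commute)
    have ze: "z = 1 / (real n + y)" using z0 by (simp add: y_def)
    have "z - 1 / real (Suc n) = (1 - y) / ((real n + 1) * (real n + y))"
      using n y by (subst ze) (simp add: divide_simps)
    then have ye: "1 - y = (z - 1 / real (Suc n)) * ((real n + 1) * (real n + y))" using n y by simp
    have "question_mark z - question_mark (1 / real (Suc n)) = (1/2) ^ n * (1 - question_mark y)"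
      using question_mark_inverse[of "Suc n"]
      unfolding ze question_mark_inverse_add[OF y Suc.hyps] by (simp add: right_diff_distrib)
    also have "\<dots> \<le> (1/2) ^ n * (2 * (1 - y))"
      using y one_minus_question_mark_le[of y] by (intro mult_left_mono) auto
    also have "\<dots> \<le> (1/2) ^ n * (2 * ((z - 1 / real (Suc n)) * ((real n + 1) * (real n + 1))))"
      using y n z by (subst ye) (intro mult_left_mono, auto)
    \<comment> \<open>This exhibits the term bounded in \<open>sq_le_two_power\<close>; 4 * 9/8
      stays below 5.\<close>
    also have "\<dots> = 4 * (z - 1 / real (Suc n)) * ((1/2) ^ Suc n * (real (Suc n) * real (Suc n)))"
      unfolding Sn power_Suc by algebra
    also have "\<dots> \<le> 4 * (z - 1 / real (Suc n)) * (9/8)"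
      using z sq_le_two_power[of "Suc n"]
      by (intro mult_left_mono) (auto simp: field_simps power_divide simp del: of_nat_Suc)
    also have "\<dots> \<le> 5 * (z - 1 / real (Suc n))" using z by simp
    finally show ?thesis .
  qed
  show ?case
  proof (cases "z \<le> 1 / real n")
    case True
    then show ?thesis using near Suc.prems by blast
  next
    case False
    have "question_mark z - question_mark (1 / real n) \<le> 5 * (z - 1 / real n)"
      using False Suc by auto
    moreover have "question_mark (1 / real n) - question_mark (1 / real (Suc n))
        \<le> 5 * (1 / real n - 1 / real (Suc n))"
      using n by (intro near) (auto simp: field_simps)
    ultimately show ?thesis by simp
  qed
qed

text \<open>
  Points in different cells of the Gauss map are separated by a unit fraction, and the estimates
  at unit fractions add up.
\<close>

lemma question_mark_diff_across_cells:
  assumes "0 < n" "1 / (real n + 1) < u" "u < 1 / real n" "z \<in> {0..1}"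
    and "z < 1 / (real n + 1) \<or> 1 / real n < z"
  shows "\<bar>question_mark z - question_mark u\<bar> \<le> 5 * \<bar>z - u\<bar>"
proof -
  have Sn: "real (Suc n) = real n + 1" by simp
  have "1 / real n \<le> 1" "0 < 1 / (real n + 1)" using assms by auto
  then have u: "0 \<le> u" "u \<le> 1" using assms by linarith+
  show ?thesis
  proof (cases "z < u")
    case True
    then have "z \<le> 1 / real (Suc n)" using assms True unfolding Sn by linarith
    then have "question_mark (1 / real (Suc n)) - question_mark z \<le> 5 * (1 / real (Suc n) - z)"
      using assms by (intro question_mark_diff_below_inverse) auto
    moreover have "question_mark u - question_mark (1 / real (Suc n)) \<le> 5 * (u - 1 / real (Suc n))"
      using assms u by (intro question_mark_diff_above_inverse) (auto simp only: Sn)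
    moreover have "question_mark z \<le> question_mark u"
      using question_mark_mono[of z u] assms True u by auto
    ultimately show ?thesis using True by auto
  next
    case False
    then have z: "1 / real n \<le> z" using assms by auto
    then have "question_mark z - question_mark (1 / real n) \<le> 5 * (z - 1 / real n)"
      using assms by (intro question_mark_diff_above_inverse) auto
    moreover have "question_mark (1 / real n) - question_mark u \<le> 5 * (1 / real n - u)"
      using assms u by (intro question_mark_diff_below_inverse) auto
    moreover have "question_mark u \<le> question_mark z"
      using question_mark_mono[of u z] assms False u by auto
    ultimately show ?thesis using False by auto
  qed
qed

text \<open>The values at \<open>u\<close> and at either end of its cell differ by at least
  \<open>(1/2) ^ 10\<close>: one factor \<open>(1/2) ^ 5\<close> comes from
  \<open>n \<le> 5\<close>, the other from \<open>v\<close> staying in \<open>[1/6, 1/2]\<close>,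
  where 1/6 has the value \<open>(1/2) ^ 5\<close>. By monotonicity \<open>z\<close> lies beyond
  such an end in value as well, and the distance of \<open>z\<close> and \<open>u\<close> is at most
  1.\<close>

lemma question_mark_diff_across_cells_ge:
  assumes "0 < n" "n \<le> 5" "u = 1 / (real n + v)" "1/6 \<le> v" "v \<le> 1/2" "z \<in> {0..1}"
    and "z < 1 / (real n + 1) \<or> 1 / real n < z"
  shows "(1/2) ^ 10 * \<bar>z - u\<bar> \<le> \<bar>question_mark z - question_mark u\<bar>"
proof -
  have v: "v \<in> {0..1}" using assms by auto
  have Fu: "question_mark u = 2 * (1/2) ^ n - (1/2) ^ n * question_mark v"
    using question_mark_inverse_add[OF v] assms by simp
  have Fv: "(1/2) ^ 5 \<le> question_mark v" "question_mark v \<le> 1/2"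
    using question_mark_mono[of "1/6" v] question_mark_mono[of v "1/2"] assms
      question_mark_inverse[of 6] question_mark_inverse[of 2] by (auto simp: power_divide)
  have n5: "(1/2) ^ 5 \<le> (1/2::real) ^ n" using assms by (intro power_decreasing) auto
  have p: "(1/2) ^ 10 \<le> (1/2) ^ n * c" if "(1/2) ^ 5 \<le> c" for c :: real
    using mult_mono[OF n5 that] by simp
  have "1 < real n + v" using assms by linarith
  then have u: "0 < u" "u < 1" using assms by auto
  have "(1/2) ^ 10 \<le> \<bar>question_mark z - question_mark u\<bar>"
  proof (cases "1 / real n < z")
    case True
    then have "2 * (1/2) ^ n \<le> question_mark z"
      using question_mark_mono[of "1 / real n" z] assms question_mark_inverse[of n] by auto
    then have "(1/2) ^ n * question_mark v \<le> \<bar>question_mark z - question_mark u\<bar>"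
      using Fu by linarith
    then show ?thesis using p[OF Fv(1)] by linarith
  next
    case False
    moreover have "real (Suc n) = real n + 1" by simp
    ultimately have "z \<le> 1 / real (Suc n)" using assms(7) by (simp only:) auto
    then have "question_mark z \<le> (1/2) ^ n"
      using question_mark_mono[of z "1 / real (Suc n)"] assms question_mark_inverse[of "Suc n"] by auto
    then have "(1/2) ^ n * (1 - question_mark v) \<le> \<bar>question_mark z - question_mark u\<bar>"
      using Fu by (simp add: algebra_simps)
    moreover have "(1/2) ^ 10 \<le> (1/2) ^ n * (1 - question_mark v)"
      using Fv by (intro p) (simp add: power_divide)
    ultimately show ?thesis by linarith
  qed
  moreover have "(1/2) ^ 10 * \<bar>z - u\<bar> \<le> (1/2) ^ 10 * 1"
    using assms(6) u by (intro mult_left_mono) (auto simp: abs_le_iff)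
  ultimately show ?thesis by linarith
qed


section \<open>Growth of continuants\<close>

text \<open>
  The standard numerators and denominators with indices shifted by one: \<open>cf_num a (Suc t)\<close> and
  \<open>cf_den a (Suc t)\<close> are \<open>p\<^sub>t\<close> and \<open>q\<^sub>t\<close>.
\<close>

fun cf_num :: "(nat \<Rightarrow> nat) \<Rightarrow> nat \<Rightarrow> nat" where
  "cf_num a 0 = 1"
| "cf_num a (Suc 0) = 0"
| "cf_num a (Suc (Suc t)) = a (Suc t) * cf_num a (Suc t) + cf_num a t"

fun cf_den :: "(nat \<Rightarrow> nat) \<Rightarrow> nat \<Rightarrow> nat" where
  "cf_den a 0 = 0"
| "cf_den a (Suc 0) = 1"
| "cf_den a (Suc (Suc t)) = a (Suc t) * cf_den a (Suc t) + cf_den a t"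

definition quotient_sum :: "(nat \<Rightarrow> nat) \<Rightarrow> nat \<Rightarrow> nat" where
  "quotient_sum a t = (\<Sum>i=1..t. a i)"

lemma quotient_sum_0: "quotient_sum a 0 = 0"
  and quotient_sum_Suc: "quotient_sum a (Suc t) = quotient_sum a t + a (Suc t)"
  by (simp_all add: quotient_sum_def)

lemma mean_partial_quotient_eq: "mean_partial_quotient a t = real (quotient_sum a t) / real t"
  by (simp add: mean_partial_quotient_def quotient_sum_def)

section \<open>The dominant eigenvalues of the matrices of the digits 4 and 5\<close>

definition lam4 :: real where "lam4 = 2 + sqrt 5"
definition lam5 :: real where "lam5 = (5 + sqrt 29) / 2"

lemma lam4_sq: "lam4 * lam4 = 4 * lam4 + 1"
  unfolding lam4_def by (simp add: algebra_simps)

lemma lam5_sq: "lam5 * lam5 = 5 * lam5 + 1"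
  unfolding lam5_def by (simp add: algebra_simps add_divide_distrib)

lemma lam4_bounds: "4.236 < lam4" "lam4 < 4.2361"
proof -
  have "2.236 < sqrt 5" by (rule real_less_rsqrt) (simp add: power2_eq_square)
  moreover have "sqrt 5 < 2.2361" by (rule real_less_lsqrt) (simp_all add: power2_eq_square)
  ultimately show "4.236 < lam4" "lam4 < 4.2361" unfolding lam4_def by simp_all
qed

lemma lam5_bounds: "5.1925 < lam5" "lam5 < 5.1926"
proof -
  have "5.385 < sqrt 29" by (rule real_less_rsqrt) (simp add: power2_eq_square)
  moreover have "sqrt 29 < 5.3852" by (rule real_less_lsqrt) (simp_all add: power2_eq_square)
  ultimately show "5.1925 < lam5" "lam5 < 5.1926" unfolding lam5_def by simp_all
qed

lemma L_const_4: "L_const 4 = ln lam4 - 2 * ln 2"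
proof -
  have "sqrt (4\<^sup>2 + 4) = sqrt (2\<^sup>2 * 5)" by simp
  also have "\<dots> = 2 * sqrt 5" by (simp only: real_sqrt_mult) simp
  finally have "(4 + sqrt (4\<^sup>2 + 4)) / 2 = lam4" by (simp add: lam4_def)
  then show ?thesis by (simp add: L_const_def)
qed

lemma L_const_5: "L_const 5 = ln lam5 - 5 * (ln 2 / 2)"
  by (simp add: L_const_def lam5_def)

text \<open>Since \<open>lam4 > 2 ^ 2\<close>, the ratio of squared denominator to
  \<open>2 ^ S\<close> grows along the constant digit 4.\<close>

lemma L_const_4_pos: "0 < L_const 4"
proof -
  have "ln ((2::real) ^ 2) < ln lam4" using lam4_bounds by simp
  then show ?thesis unfolding L_const_4 using ln_realpow[of "2::real" 2] by simp
qed

text \<open>Since \<open>lam5 ^ 2 = 5 * lam5 + 1 < 2 ^ 5\<close>, the same ratio decays along the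
  constant digit 5.\<close>

lemma L_const_5_neg: "L_const 5 < 0"
proof -
  have "ln (lam5 ^ 2) < ln ((2::real) ^ 5)"
    using lam5_bounds by (simp add: power2_eq_square lam5_sq)
  then show ?thesis
    unfolding L_const_5 using ln_realpow[of "2::real" 5] ln_realpow[of lam5 2] lam5_bounds by simp
qed

text \<open>
  The maximum of the left eigenvectors of the matrices \<open>((a, 1), (1, 0))\<close> for \<open>a = 4, 5\<close>,
  normalised to agree at \<open>q' = q / 5\<close>. For \<open>0 \<le> q' \<le> q\<close> the digit 4 sends \<open>(q, q')\<close> to the side
  of this line where the eigenvector of 4 dominates, and the digit 5 to the side of 5.
\<close>

definition extremal :: "real \<Rightarrow> real \<Rightarrow> real" where
  "extremal q q' = max ((lam4 * q + q') / (lam4 + 1/5)) ((lam5 * q + q') / (lam5 + 1/5))"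

lemma lam_ratio_bounds: "(122577/100000) < lam5 / lam4" "lam5 / lam4 < (122583/100000)"
  using lam4_bounds lam5_bounds by (auto simp: field_simps)

text \<open>The logarithm of the weight is the affine function of the digit with values
  \<open>ln lam4\<close> at 4 and \<open>ln lam5\<close> at 5. A product of weights therefore
  depends only on the digit sum and the number of digits.\<close>

definition digit_weight :: "nat \<Rightarrow> real" where
  "digit_weight a = lam4 * (lam5 / lam4) powr (real a - 4)"

lemma digit_weight_Suc: "digit_weight (Suc a) = digit_weight a * (lam5 / lam4)"
proof -
  have "(lam5 / lam4) powr (real a - 4 + 1) = (lam5 / lam4) powr (real a - 4) * (lam5 / lam4)"
    by (subst powr_add) (use lam4_bounds lam5_bounds in simp)
  moreover have "real (Suc a) - 4 = real a - 4 + 1" by simp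
  ultimately show ?thesis by (simp only: digit_weight_def mult.assoc)
qed

lemma digit_weight_4: "digit_weight 4 = lam4"
  and digit_weight_5: "digit_weight 5 = lam5"
  using lam4_bounds lam5_bounds by (simp_all add: digit_weight_def)

lemma digit_weight_pos: "0 < digit_weight a"
  using lam4_bounds lam5_bounds by (simp add: digit_weight_def)

lemma digit_weight_bounds:
  "3.455 < digit_weight 3" "2.818 < digit_weight 2" "2.298 < digit_weight 1" "6.364 < digit_weight 6"
proof -
  \<comment> \<open>Lower bounds descend from the digit 4 by dividing by the upper bound of
    \<open>lam5 / lam4\<close>.\<close>
  have step: "b < digit_weight n" if "c < digit_weight (Suc n)" "b * (122583/100000) \<le> c" "0 < b" for b c n
  proof -
    have "digit_weight n * (lam5 / lam4) \<le> digit_weight n * (122583/100000)"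
      using lam_ratio_bounds digit_weight_pos[of n] by (intro mult_left_mono) auto
    then have "b * (122583/100000) < digit_weight n * (122583/100000)"
      using that unfolding digit_weight_Suc by linarith
    then show ?thesis by simp
  qed
  have 4: "4.236 < digit_weight (Suc 3)" using digit_weight_4 lam4_bounds by simp
  show 3: "3.455 < digit_weight 3" by (rule step[OF 4]) auto
  then have 3: "3.455 < digit_weight (Suc 2)" by (simp add: numeral_eq_Suc)
  show 2: "2.818 < digit_weight 2" by (rule step[OF 3]) auto
  then have 2: "2.818 < digit_weight (Suc 1)" by (simp add: numeral_eq_Suc)
  show "2.298 < digit_weight 1" by (rule step[OF 2]) auto
  have "5.1925 * (122577/100000) < digit_weight 5 * (lam5 / lam4)"
    using lam_ratio_bounds lam5_bounds by (intro mult_strict_mono) (auto simp: digit_weight_5)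
  then show "6.364 < digit_weight 6" using digit_weight_Suc[of 5] by simp
qed

lemma extremal_ge:
  shows "(lam4 * q + q') / (lam4 + 1/5) \<le> extremal q q'"
    and "(lam5 * q + q') / (lam5 + 1/5) \<le> extremal q q'"
  by (simp_all add: extremal_def)

lemma extremal_eq_4:
  assumes "q \<le> 5 * q'"
  shows "extremal q q' = (lam4 * q + q') / (lam4 + 1/5)"
proof -
  have "(lam5 - lam4) * q \<le> (lam5 - lam4) * (5 * q')"
    using assms lam4_bounds lam5_bounds by (intro mult_left_mono) auto
  then have "(lam5 * q + q') * (lam4 + 1/5) \<le> (lam4 * q + q') * (lam5 + 1/5)"
    by (simp add: field_simps)
  then have "(lam5 * q + q') / (lam5 + 1/5) \<le> (lam4 * q + q') / (lam4 + 1/5)"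
    using lam4_bounds lam5_bounds by (simp add: divide_le_eq le_divide_eq mult.commute)
  then show ?thesis by (simp add: extremal_def)
qed

lemma extremal_eq_5:
  assumes "5 * q' \<le> q"
  shows "extremal q q' = (lam5 * q + q') / (lam5 + 1/5)"
proof -
  have "(lam5 - lam4) * (5 * q') \<le> (lam5 - lam4) * q"
    using assms lam4_bounds lam5_bounds by (intro mult_left_mono) auto
  then have "(lam4 * q + q') * (lam5 + 1/5) \<le> (lam5 * q + q') * (lam4 + 1/5)"
    by (simp add: field_simps)
  then have "(lam4 * q + q') / (lam4 + 1/5) \<le> (lam5 * q + q') / (lam5 + 1/5)"
    using lam4_bounds lam5_bounds by (simp add: divide_le_eq le_divide_eq mult.commute)
  then show ?thesis by (simp add: extremal_def)
qed

text \<open>Equivalently, \<open>(lam4, 1)\<close> is a left eigenvector of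
  \<open>((4, 1), (1, 0))\<close>; \<open>lam5_mult\<close> is the analogue for 5.\<close>

lemma lam4_mult: "lam4 * (4 * q + q') + q = lam4 * (lam4 * q + q')"
proof -
  have "lam4 * (lam4 * q + q') = (lam4 * lam4) * q + lam4 * q'" by (simp add: algebra_simps)
  then show ?thesis unfolding lam4_sq by (simp add: algebra_simps)
qed

lemma lam5_mult: "lam5 * (5 * q + q') + q = lam5 * (lam5 * q + q')"
proof -
  have "lam5 * (lam5 * q + q') = (lam5 * lam5) * q + lam5 * q'" by (simp add: algebra_simps)
  then show ?thesis unfolding lam5_sq by (simp add: algebra_simps)
qed

text \<open>The new pair satisfies \<open>4 * q + q' \<le> 5 * q\<close>, so its norm is given by
  the eigenvector of 4 alone, which the digit 4 multiplies exactly by \<open>lam4\<close>.\<close>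

lemma extremal_step_4:
  assumes "q' \<le> q"
  shows "extremal (4 * q + q') q \<le> lam4 * extremal q q'"
proof -
  have "extremal (4 * q + q') q = (lam4 * (4 * q + q') + q) / (lam4 + 1/5)"
    using assms by (intro extremal_eq_4) simp
  also have "\<dots> = lam4 * ((lam4 * q + q') / (lam4 + 1/5))" by (simp add: lam4_mult)
  also have "\<dots> \<le> lam4 * extremal q q'"
    using lam4_bounds by (intro mult_left_mono extremal_ge) auto
  finally show ?thesis .
qed

lemma extremal_step_5:
  assumes "0 \<le> q'"
  shows "extremal (5 * q + q') q \<le> lam5 * extremal q q'"
proof -
  have "extremal (5 * q + q') q = (lam5 * (5 * q + q') + q) / (lam5 + 1/5)"
    using assms by (intro extremal_eq_5) simp
  also have "\<dots> = lam5 * ((lam5 * q + q') / (lam5 + 1/5))" by (simp add: lam5_mult)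
  also have "\<dots> \<le> lam5 * extremal q q'"
    using lam5_bounds by (intro mult_left_mono extremal_ge) auto
  finally show ?thesis .
qed

text \<open>Digits below 4 also lead to the side of the eigenvector of 4. There the inequality has
  room to spare, and rational enclosures decide it.\<close>

lemma extremal_step_small:
  assumes "0 \<le> q'" "q' \<le> q" "a \<in> {1, 2, 3}"
  shows "extremal (real a * q + q') q \<le> digit_weight a * extremal q q'"
proof -
  have q: "0 \<le> q" using assms by simp
  have b: "4.236 * q \<le> lam4 * q" "lam4 * q \<le> 4.2361 * q" "lam4 * q' \<le> 4.2361 * q'"
    "4.236 * q' \<le> lam4 * q'"
    using lam4_bounds assms q by - (rule mult_right_mono; linarith)+
  have w: "c * (lam4 * q + q') \<le> digit_weight a * (lam4 * q + q')" if "c < digit_weight a" for c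
    using that assms b q by (intro mult_right_mono) auto
  \<comment> \<open>The coefficient of \<open>q'\<close> is larger on the left for each of these
    digits; the surplus in the coefficient of \<open>q\<close> compensates because
    \<open>q' \<le> q\<close>.\<close>
  have "lam4 * (real a * q + q') + q \<le> digit_weight a * (lam4 * q + q')"
    using assms(3)
  proof (elim insertE emptyE)
    assume "a = 1"
    then show ?thesis using w[of "2.298"] digit_weight_bounds(3) b assms q by (simp add: algebra_simps)
  next
    assume "a = 2"
    then show ?thesis using w[of "2.818"] digit_weight_bounds(2) b assms q by (simp add: algebra_simps)
  next
    assume "a = 3"
    then show ?thesis using w[of "3.455"] digit_weight_bounds(1) b assms q by (simp add: algebra_simps)
  qed
  then have "(lam4 * (real a * q + q') + q) / (lam4 + 1/5)
      \<le> digit_weight a * (lam4 * q + q') / (lam4 + 1/5)"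
    using lam4_bounds by (intro divide_right_mono) auto
  also have "\<dots> \<le> digit_weight a * extremal q q'"
    using mult_left_mono[OF extremal_ge(1)[of q q'], of "digit_weight a"] digit_weight_pos[of a] by simp
  also have "(lam4 * (real a * q + q') + q) / (lam4 + 1/5) = extremal (real a * q + q') q"
    using assms q by (intro extremal_eq_4[symmetric]) auto
  finally show ?thesis .
qed

text \<open>Digits from 6 on lead to the side of the eigenvector of 5. Increasing the digit by one
  multiplies the left side by at most 7/6, but the weight by \<open>lam5 / lam4\<close>, which
  exceeds 1.22.\<close>

lemma extremal_step_large:
  assumes "0 \<le> q'" "q' \<le> q" "6 \<le> a"
  shows "extremal (real a * q + q') q \<le> digit_weight a * extremal q q'"
proof -
  have q: "0 \<le> q" using assms by simp
  have b: "5.1925 * q \<le> lam5 * q" "lam5 * q \<le> 5.1926 * q" "lam5 * q' \<le> 5.1926 * q'"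
    "5.1925 * q' \<le> lam5 * q'"
    using lam5_bounds assms q by - (rule mult_right_mono; linarith)+
  have "lam5 * (real a * q + q') + q \<le> digit_weight a * (lam5 * q + q')"
    using assms(3)
  proof (induction a rule: dec_induct)
    case base
    have "6.364 * (lam5 * q + q') \<le> digit_weight 6 * (lam5 * q + q')"
      using digit_weight_bounds(4) assms b q by (intro mult_right_mono) auto
    then show ?case using b assms q by (simp add: algebra_simps)
  next
    case (step n)
    let ?x = "lam5 * (real n * q + q') + q"
    have "6 * (lam5 * q) \<le> real n * (lam5 * q)" using step b q by (intro mult_right_mono) auto
    then have x: "6 * (lam5 * q) \<le> ?x" using b assms q by (simp add: algebra_simps)
    then have "0 \<le> ?x" using b q by linarith
    have "lam5 * (real (Suc n) * q + q') + q = ?x + lam5 * q" by (simp add: algebra_simps)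
    also have "\<dots> \<le> ?x * (122577/100000)"
    proof -
      have "v + w \<le> v * (122577/100000)" if "6 * w \<le> v" "0 \<le> v" for v w :: real
        using that by linarith
      then show ?thesis using x \<open>0 \<le> ?x\<close> by blast
    qed
    also have "\<dots> \<le> ?x * (lam5 / lam4)"
      using lam_ratio_bounds \<open>0 \<le> ?x\<close> by (intro mult_left_mono) auto
    also have "\<dots> \<le> digit_weight n * (lam5 * q + q') * (lam5 / lam4)"
      using step.IH lam4_bounds lam5_bounds by (intro mult_right_mono) auto
    finally show ?case by (simp add: digit_weight_Suc mult_ac)
  qed
  then have "(lam5 * (real a * q + q') + q) / (lam5 + 1/5)
      \<le> digit_weight a * (lam5 * q + q') / (lam5 + 1/5)"
    using lam5_bounds by (intro divide_right_mono) auto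
  also have "\<dots> \<le> digit_weight a * extremal q q'"
    using mult_left_mono[OF extremal_ge(2)[of q q'], of "digit_weight a"] digit_weight_pos[of a] by simp
  also have "(lam5 * (real a * q + q') + q) / (lam5 + 1/5) = extremal (real a * q + q') q"
  proof (rule extremal_eq_5[symmetric])
    have "6 * q \<le> real a * q" using assms q by (intro mult_right_mono) auto
    then show "5 * q \<le> real a * q + q'" using assms q by linarith
  qed
  finally show ?thesis .
qed

lemma extremal_step:
  assumes "0 < a" "0 \<le> q'" "q' \<le> q"
  shows "extremal (real a * q + q') q \<le> digit_weight a * extremal q q'"
proof -
  consider "a \<in> {1, 2, 3}" | "a = 4" | "a = 5" | "6 \<le> a" using assms(1) by force
  then show ?thesis
  proof cases
    case 1
    then show ?thesis using extremal_step_small assms by blast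
  next
    case 2
    then show ?thesis using extremal_step_4 assms by (simp add: digit_weight_4)
  next
    case 3
    then show ?thesis using extremal_step_5 assms by (simp add: digit_weight_5)
  next
    case 4
    then show ?thesis using extremal_step_large assms by blast
  qed
qed

section \<open>Growth of the denominators\<close>

lemma cf_den_mono_Suc:
  assumes "\<forall>i\<ge>1. 0 < a i"
  shows "cf_den a t \<le> cf_den a (Suc t)"
proof (cases t)
  case 0
  then show ?thesis by simp
next
  case (Suc s)
  have "0 < a (Suc s)" using assms by simp
  then have "cf_den a (Suc s) \<le> a (Suc s) * cf_den a (Suc s)" by simp
  then show ?thesis unfolding Suc cf_den.simps by linarith
qed

lemma cf_den_Suc_pos:
  assumes "\<forall>i\<ge>1. 0 < a i"
  shows "0 < cf_den a (Suc t)"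
proof (induction t)
  case 0
  then show ?case by simp
next
  case (Suc t)
  then show ?case using cf_den_mono_Suc[OF assms, of "Suc t"] by linarith
qed

text \<open>This linear growth is enough for the irrationality argument and for shrinking the
  cylinders.\<close>

lemma cf_den_ge:
  assumes "\<forall>i\<ge>1. 0 < a i"
  shows "t \<le> cf_den a (Suc t)"
proof (induction t)
  case 0
  then show ?case by simp
next
  case (Suc t)
  have "0 < a (Suc t)" using assms by simp
  then have le: "cf_den a (Suc t) \<le> a (Suc t) * cf_den a (Suc t)" by simp
  show ?case
  proof (cases t)
    case 0
    then show ?thesis using \<open>0 < a (Suc t)\<close> by simp
  next
    case (Suc s)
    then have "0 < cf_den a t" using cf_den_Suc_pos[OF assms] by simp
    then show ?thesis using le Suc.IH \<open>t \<le> cf_den a (Suc t)\<close> unfolding cf_den.simps by linarith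
  qed
qed

text \<open>The extremal norm gains at most the weight of the digit in each step. Its initial value
  at \<open>(1, 0)\<close> is \<open>c\<close>, and it is at least \<open>c * q\<close> at every
  \<open>(q, q')\<close>, so the constant cancels.\<close>

lemma cf_den_le_prod_digit_weight:
  assumes "\<forall>i\<ge>1. 0 < a i"
  shows "real (cf_den a (Suc t)) \<le> (\<Prod>i=1..t. digit_weight (a i))"
proof -
  define c where "c = lam5 / (lam5 + 1/5)"
  have c: "0 < c" using lam5_bounds by (simp add: c_def)
  have "extremal (cf_den a (Suc t)) (cf_den a t) \<le> (\<Prod>i=1..t. digit_weight (a i)) * c"
  proof (induction t)
    case 0
    show ?case using extremal_eq_5[of 0 1] by (simp add: c_def)
  next
    case (Suc t)
    have "extremal (cf_den a (Suc (Suc t))) (cf_den a (Suc t))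
        \<le> digit_weight (a (Suc t)) * extremal (cf_den a (Suc t)) (cf_den a t)"
      using extremal_step[of "a (Suc t)" "cf_den a t" "cf_den a (Suc t)"] assms cf_den_mono_Suc[OF assms, of t]
      by simp
    also have "\<dots> \<le> digit_weight (a (Suc t)) * ((\<Prod>i=1..t. digit_weight (a i)) * c)"
      using Suc digit_weight_pos[of "a (Suc t)"] by (intro mult_left_mono) auto
    finally show ?case by (simp add: mult_ac)
  qed
  moreover have "c * real (cf_den a (Suc t)) \<le> extremal (cf_den a (Suc t)) (cf_den a t)"
  proof -
    have "c * real (cf_den a (Suc t)) \<le> (lam5 * cf_den a (Suc t) + cf_den a t) / (lam5 + 1/5)"
      using lam5_bounds by (simp add: c_def divide_right_mono)
    then show ?thesis using extremal_ge(2)[of "cf_den a (Suc t)" "cf_den a t"] by linarith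
  qed
  ultimately have "real (cf_den a (Suc t)) * c \<le> (\<Prod>i=1..t. digit_weight (a i)) * c"
    by (simp only: mult.commute[of c])
  then show ?thesis using c by simp
qed

text \<open>This is where \<open>kappa2\<close> enters: it is the zero of the affine function of the
  digit that interpolates \<open>L_const\<close> at 4 and 5.\<close>

lemma digit_weight_sq:
  "(1/2) ^ a * (digit_weight a)\<^sup>2
    = exp (2 * ((L_const 5 - L_const 4) * (real a - kappa2)))"
proof -
  have "(1/2) ^ a = exp (real a * ln (1/2))" by (subst exp_of_nat_mult) simp
  moreover have "(lam5 / lam4) powr (real a - 4) = exp ((real a - 4) * (ln lam5 - ln lam4))"
    using lam4_bounds lam5_bounds by (simp add: powr_def ln_div)
  moreover have "lam4 = exp (ln lam4)" using lam4_bounds by simp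
  ultimately have "(1/2) ^ a * (digit_weight a)\<^sup>2
      = exp (real a * ln (1/2)) * (exp (ln lam4) * exp ((real a - 4) * (ln lam5 - ln lam4)))\<^sup>2"
    unfolding digit_weight_def by metis
  also have "\<dots> = exp (- real a * ln 2 + 2 * (ln lam4 + (real a - 4) * (ln lam5 - ln lam4)))"
    by (simp add: ln_div power2_eq_square flip: exp_add)
  also have "- real a * ln 2 + 2 * (ln lam4 + (real a - 4) * (ln lam5 - ln lam4))
      = 2 * ((L_const 5 - L_const 4) * real a - (4 * L_const 5 - 5 * L_const 4))"
    unfolding L_const_4 L_const_5 by (simp add: field_simps)
  also have "4 * L_const 5 - 5 * L_const 4 = (L_const 5 - L_const 4) * kappa2"
    using L_const_4_pos L_const_5_neg by (simp add: kappa2_def)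
  finally show ?thesis by (simp add: right_diff_distrib)
qed

lemma cf_den_sq_le:
  assumes "\<forall>i\<ge>1. 0 < a i"
  shows "(1/2) ^ quotient_sum a t * (real (cf_den a (Suc t)))\<^sup>2
    \<le> exp (2 * ((L_const 5 - L_const 4) * (real (quotient_sum a t) - kappa2 * real t)))"
proof -
  have "(1/2) ^ quotient_sum a t * (real (cf_den a (Suc t)))\<^sup>2
      \<le> (1/2) ^ quotient_sum a t * (\<Prod>i=1..t. digit_weight (a i))\<^sup>2"
    by (intro mult_left_mono power_mono cf_den_le_prod_digit_weight assms) auto
  also have "\<dots> = (\<Prod>i=1..t. (1/2) ^ a i * (digit_weight (a i))\<^sup>2)"
    by (simp add: quotient_sum_def power_sum prod_power_distrib prod.distrib)
  also have "\<dots> = exp (\<Sum>i=1..t. 2 * ((L_const 5 - L_const 4) * (real (a i) - kappa2)))"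
    by (simp add: digit_weight_sq exp_sum)
  also have "(\<Sum>i=1..t. 2 * ((L_const 5 - L_const 4) * (real (a i) - kappa2)))
      = 2 * ((L_const 5 - L_const 4) * (real (quotient_sum a t) - kappa2 * real t))"
    by (simp add: quotient_sum_def sum_subtractf right_diff_distrib sum_distrib_left mult_ac)
  finally show ?thesis .
qed


section \<open>Difference quotients along cylinders\<close>

text \<open>The Gauss map along the prescribed digits of \<open>a\<close> instead of those of
  \<open>y\<close>. The result is a genuine remainder as long as \<open>y\<close> stays in the
  closed cylinder described by \<open>in_cylinder\<close>.\<close>

primrec cf_rem :: "(nat \<Rightarrow> nat) \<Rightarrow> nat \<Rightarrow> real \<Rightarrow> real" where
  "cf_rem a 0 y = y"
| "cf_rem a (Suc t) y = 1 / cf_rem a t y - real (a (Suc t))"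

definition in_cylinder :: "(nat \<Rightarrow> nat) \<Rightarrow> nat \<Rightarrow> real \<Rightarrow> bool" where
  "in_cylinder a t y \<longleftrightarrow> (\<forall>s\<le>t. cf_rem a s y \<in> {0..1})"

lemma cf_num_den_det:
  "real (cf_num a t) * real (cf_den a (Suc t)) - real (cf_num a (Suc t)) * real (cf_den a t) = (-1) ^ t"
proof (induction t)
  case 0
  then show ?case by simp
next
  case (Suc t)
  then show ?case by (simp add: algebra_simps)
qed

text \<open>The usual expression of \<open>y\<close> through its remainder, with the denominator
  multiplied out so that its sign does not matter in the induction.\<close>

lemma cf_rem_moebius:
  assumes "\<And>s. s < t \<Longrightarrow> cf_rem a s y \<noteq> 0"
  shows "y * (cf_den a t * cf_rem a t y + cf_den a (Suc t)) = cf_num a t * cf_rem a t y + cf_num a (Suc t)"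
  using assms
proof (induction t)
  case 0
  then show ?case by simp
next
  case (Suc t)
  let ?z = "cf_rem a t y"
  have z: "?z \<noteq> 0" using Suc.prems by simp
  have IH: "y * (cf_den a t * ?z + cf_den a (Suc t)) = cf_num a t * ?z + cf_num a (Suc t)"
    using Suc by simp
  have eq: "cf_rem a (Suc t) y = 1 / ?z - real (a (Suc t))" by simp
  have "y * (cf_den a (Suc t) * cf_rem a (Suc t) y + cf_den a (Suc (Suc t)))
      = y * (cf_den a t * ?z + cf_den a (Suc t)) / ?z"
    unfolding eq using z by (simp add: field_simps)
  also have "\<dots> = (cf_num a t * ?z + cf_num a (Suc t)) / ?z" by (simp only: IH)
  also have "\<dots> = cf_num a (Suc t) * cf_rem a (Suc t) y + cf_num a (Suc (Suc t))"
    unfolding eq using z by (simp add: field_simps)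
  finally show ?case .
qed

context
  fixes a :: "nat \<Rightarrow> nat"
  assumes digit_pos: "\<forall>i\<ge>1. 0 < a i"
begin

lemma in_cylinder_Suc_pos:
  assumes "in_cylinder a (Suc t) y"
  shows "0 < cf_rem a t y"
proof (rule ccontr)
  assume "\<not> 0 < cf_rem a t y"
  moreover have "0 \<le> cf_rem a t y" "0 \<le> cf_rem a (Suc t) y"
    using assms by (auto simp: in_cylinder_def simp del: cf_rem.simps)
  \<comment> \<open>As \<open>1 / 0 = 0\<close>, a vanishing remainder would be followed by the
    negative number \<open>- a (Suc t)\<close>.\<close>
  moreover have "0 < a (Suc t)" using digit_pos by simp
  ultimately show False by auto
qed

lemma in_cylinder_mono: "in_cylinder a t y \<Longrightarrow> s \<le> t \<Longrightarrow> in_cylinder a s y"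
  by (simp add: in_cylinder_def)

lemma in_cylinder_moebius:
  assumes "in_cylinder a t y"
  shows "y * (cf_den a t * cf_rem a t y + cf_den a (Suc t)) = cf_num a t * cf_rem a t y + cf_num a (Suc t)"
proof (rule cf_rem_moebius)
  fix s assume "s < t"
  then show "cf_rem a s y \<noteq> 0"
    using in_cylinder_Suc_pos[of s y] in_cylinder_mono[OF assms, of "Suc s"] by auto
qed

lemma in_cylinder_den_bounds:
  assumes "in_cylinder a t y"
  shows "real (cf_den a (Suc t)) \<le> cf_den a t * cf_rem a t y + cf_den a (Suc t)"
    and "cf_den a t * cf_rem a t y + cf_den a (Suc t) \<le> 2 * real (cf_den a (Suc t))"
    and "0 < cf_den a t * cf_rem a t y + cf_den a (Suc t)"
proof -
  have z: "0 \<le> cf_rem a t y" "cf_rem a t y \<le> 1" using assms by (auto simp: in_cylinder_def)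
  have "cf_den a t * cf_rem a t y \<le> real (cf_den a (Suc t)) * 1"
    using z cf_den_mono_Suc[OF digit_pos, of t] by (intro mult_mono) auto
  then show "cf_den a t * cf_rem a t y + cf_den a (Suc t) \<le> 2 * real (cf_den a (Suc t))" by simp
  show le: "real (cf_den a (Suc t)) \<le> cf_den a t * cf_rem a t y + cf_den a (Suc t)" using z by simp
  moreover have "0 < real (cf_den a (Suc t))" using cf_den_Suc_pos[OF digit_pos] by simp
  ultimately show "0 < cf_den a t * cf_rem a t y + cf_den a (Suc t)" by linarith
qed

lemma in_cylinder_diff:
  assumes "in_cylinder a t x" "in_cylinder a t y"
  shows "y - x = (-1) ^ t * (cf_rem a t y - cf_rem a t x) /
    ((cf_den a t * cf_rem a t y + cf_den a (Suc t)) * (cf_den a t * cf_rem a t x + cf_den a (Suc t)))"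
proof -
  let ?D = "\<lambda>y. cf_den a t * cf_rem a t y + cf_den a (Suc t)"
  let ?N = "\<lambda>y. cf_num a t * cf_rem a t y + cf_num a (Suc t)"
  have pos: "0 < ?D x" "0 < ?D y" using assms in_cylinder_den_bounds by auto
  have "(y - x) * (?D y * ?D x) = (y * ?D y) * ?D x - (x * ?D x) * ?D y" by (simp only: algebra_simps)
  also have "\<dots> = ?N y * ?D x - ?N x * ?D y" using assms by (simp only: in_cylinder_moebius)
  also have "\<dots> = (real (cf_num a t) * real (cf_den a (Suc t)) - real (cf_num a (Suc t)) * real (cf_den a t))
      * (cf_rem a t y - cf_rem a t x)" by algebra
  finally have "(y - x) * (?D y * ?D x) = (-1) ^ t * (cf_rem a t y - cf_rem a t x)"
    by (simp only: cf_num_den_det)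
  then show ?thesis using pos by (simp add: eq_divide_eq)
qed

text \<open>Each Gauss step is affine on values with slope \<open>- (1/2) ^ a (Suc t)\<close>, so
  differences pick up a sign and the power of 1/2 given by the digit sum.\<close>

lemma in_cylinder_question_mark_diff:
  assumes "in_cylinder a t x" "in_cylinder a t y"
  shows "question_mark y - question_mark x
    = (-1) ^ t * (1/2) ^ quotient_sum a t * (question_mark (cf_rem a t y) - question_mark (cf_rem a t x))"
  using assms
proof (induction t)
  case 0
  then show ?case by (simp add: quotient_sum_0)
next
  case (Suc t)
  have step: "question_mark (cf_rem a t w)
      = 2 * (1/2) ^ a (Suc t) - (1/2) ^ a (Suc t) * question_mark (cf_rem a (Suc t) w)"
    if "in_cylinder a (Suc t) w" for w
  proof -
    have "cf_rem a t w = 1 / (real (a (Suc t)) + cf_rem a (Suc t) w)"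
      using in_cylinder_Suc_pos[OF that] by simp
    moreover have "cf_rem a (Suc t) w \<in> {0..1}" using that by (simp add: in_cylinder_def del: cf_rem.simps)
    moreover have "0 < a (Suc t)" using digit_pos by simp
    ultimately show ?thesis using question_mark_inverse_add[of "cf_rem a (Suc t) w" "a (Suc t)"] by (simp only:)
  qed
  have "question_mark y - question_mark x
    = (-1) ^ t * (1/2) ^ quotient_sum a t * (question_mark (cf_rem a t y) - question_mark (cf_rem a t x))"
    using Suc in_cylinder_mono[of "Suc t"] by simp
  then show ?case
    unfolding step[OF Suc.prems(1)] step[OF Suc.prems(2)] quotient_sum_Suc power_add power_Suc
    by (simp only: algebra_simps)
qed

lemma not_in_cylinder_Suc:
  assumes "in_cylinder a t y" "\<not> in_cylinder a (Suc t) y"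
  shows "cf_rem a t y < 1 / (real (a (Suc t)) + 1) \<or> 1 / real (a (Suc t)) < cf_rem a t y"
proof (rule ccontr)
  assume "\<not> ?thesis"
  then have "cf_rem a (Suc t) y \<in> {0..1}"
    using cell_rem(1)[of "a (Suc t)" "cf_rem a t y"] digit_pos by (auto simp: not_less)
  then show False using assms by (auto simp: in_cylinder_def le_Suc_eq simp del: cf_rem.simps)
qed

section \<open>Points whose remainders all lie strictly between 0 and 1\<close>

context
  fixes x :: real
  assumes rem_mem: "\<And>t. cf_rem a t x \<in> {0<..<1}"
begin

lemma in_cylinder_self: "in_cylinder a t x"
  unfolding in_cylinder_def using rem_mem
  by (meson atLeastAtMost_iff greaterThanLessThan_iff less_imp_le)

lemma rem_cell: "1 / (real (a (Suc t)) + 1) < cf_rem a t x" "cf_rem a t x < 1 / real (a (Suc t))"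
proof -
  have "0 < a (Suc t)" "0 < cf_rem a t x" "0 < cf_rem a (Suc t) x" "cf_rem a (Suc t) x < 1"
    using digit_pos rem_mem[of t] rem_mem[of "Suc t"] by auto
  then show "1 / (real (a (Suc t)) + 1) < cf_rem a t x" "cf_rem a t x < 1 / real (a (Suc t))"
    by (auto simp: field_simps)
qed

text \<open>If \<open>x = m / n\<close>, then \<open>m * q - n * p\<close> for the convergent
  \<open>p / q\<close> with index \<open>n + 1\<close> would be an integer of absolute value
  strictly between 0 and 1.\<close>

lemma irrational: "x \<notin> \<rat>"
proof
  assume "x \<in> \<rat>"
  then obtain m n :: nat where mn: "n \<noteq> 0" "\<bar>x\<bar> = real m / real n"
    by (rule Rats_abs_nat_div_natE)
  have "0 < x" using rem_mem[of 0] by simp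
  with mn have x: "x * real n = real m" by simp
  define t where "t = Suc n"
  let ?z = "cf_rem a t x" and ?D = "cf_den a t * cf_rem a t x + cf_den a (Suc t)"
  have z: "0 < ?z" "?z < 1" using rem_mem[of t] by auto
  have "Suc n \<le> cf_den a (Suc t)" using cf_den_ge[OF digit_pos, of t] t_def by simp
  then have D: "real n < ?D"
    using in_cylinder_den_bounds(1)[OF in_cylinder_self, of t] by linarith
  define k where "k = int m * int (cf_den a (Suc t)) - int n * int (cf_num a (Suc t))"
  have "(x * cf_den a (Suc t) - cf_num a (Suc t)) * ?D
      = (x * ?D) * cf_den a (Suc t) - cf_num a (Suc t) * ?D" by algebra
  also have "\<dots> = (real (cf_num a t) * real (cf_den a (Suc t)) - real (cf_num a (Suc t)) * real (cf_den a t)) * ?z"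
    unfolding in_cylinder_moebius[OF in_cylinder_self] by algebra
  finally have "(x * cf_den a (Suc t) - cf_num a (Suc t)) * ?D = (-1) ^ t * ?z"
    by (simp only: cf_num_den_det)
  then have "\<bar>(x * cf_den a (Suc t) - cf_num a (Suc t)) * ?D\<bar> = \<bar>(-1) ^ t * ?z\<bar>"
    by (simp only:)
  moreover have "\<bar>?D\<bar> = ?D" "\<bar>?z\<bar> = ?z" using z D by simp_all
  ultimately have "\<bar>x * cf_den a (Suc t) - cf_num a (Suc t)\<bar> * ?D = ?z"
    by (simp only: abs_mult power_abs) simp
  moreover have "real_of_int k = (x * cf_den a (Suc t) - cf_num a (Suc t)) * real n"
    using x by (simp add: k_def algebra_simps)
  ultimately have k: "\<bar>real_of_int k\<bar> * ?D = ?z * real n"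
    by (simp only: abs_mult abs_of_nat mult_ac)
  have "0 < ?z * real n" "?z * real n < 1 * ?D"
    using z D mn by (auto intro: order.strict_trans1[OF mult_left_le_one_le])
  then have "0 < \<bar>real_of_int k\<bar> * ?D" "\<bar>real_of_int k\<bar> * ?D < 1 * ?D" using k by simp_all
  then have "0 < \<bar>real_of_int k\<bar>" "\<bar>real_of_int k\<bar> < 1"
    using D by (auto simp: zero_less_mult_iff mult_less_cancel_right)
  then show False by auto
qed

text \<open>Finitely many conditions are involved, each stating that a map continuous at
  \<open>x\<close> stays near a value in the open unit interval.\<close>

lemma eventually_in_cylinder: "eventually (\<lambda>y. in_cylinder a t y) (at x)"
proof -
  have lim: "(cf_rem a s \<longlongrightarrow> cf_rem a s x) (at x)" for s
  proof (induction s)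
    case 0
    show ?case by simp
  next
    case (Suc s)
    have "cf_rem a s x \<noteq> 0" using rem_mem[of s] by auto
    then show ?case using Suc by (auto intro!: tendsto_intros)
  qed
  have "eventually (\<lambda>y. \<forall>s\<in>{..t}. cf_rem a s y \<in> {0..1}) (at x)"
  proof (rule eventually_ball_finite)
    show "\<forall>s\<in>{..t}. eventually (\<lambda>y. cf_rem a s y \<in> {0..1}) (at x)"
    proof
      fix s
      have "eventually (\<lambda>y. cf_rem a s y \<in> {0<..<1}) (at x)"
        by (rule topological_tendstoD[OF lim]) (use rem_mem in auto)
      then show "eventually (\<lambda>y. cf_rem a s y \<in> {0..1}) (at x)"
        by (rule eventually_mono) auto
    qed
  qed simp
  then show ?thesis by (simp add: in_cylinder_def Ball_def)
qed

text \<open>Two points of the cylinder of depth \<open>t\<close> are at distance at most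
  \<open>1 / t\<close>, so a point other than \<open>x\<close> leaves at some depth. The cylinders
  are nested, hence the first exit comes after depth \<open>s\<close>.\<close>

lemma leaves_cylinder:
  assumes "in_cylinder a s y" "y \<noteq> x"
  obtains t where "s \<le> t" "in_cylinder a t y" "\<not> in_cylinder a (Suc t) y"
proof -
  have "\<exists>t. \<not> in_cylinder a t y"
  proof (rule ccontr)
    assume "\<nexists>t. \<not> in_cylinder a t y"
    then have all: "in_cylinder a t y" for t by blast
    obtain n where n: "1 / real (Suc n) < \<bar>y - x\<bar>"
      using reals_Archimedean[of "\<bar>y - x\<bar>"] assms(2) by (auto simp: inverse_eq_divide)
    let ?t = "Suc n"
    let ?D = "\<lambda>y. cf_den a ?t * cf_rem a ?t y + cf_den a (Suc ?t)"
    have "real ?t \<le> real (cf_den a (Suc ?t))" using cf_den_ge[OF digit_pos] of_nat_le_iff by blast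
    then have D: "real ?t \<le> ?D y" "real ?t \<le> ?D x"
      using in_cylinder_den_bounds(1)[OF all[of ?t]] in_cylinder_den_bounds(1)[OF in_cylinder_self[of ?t]]
      by linarith+
    have DD: "real ?t * 1 \<le> ?D y * ?D x" using D by (intro mult_mono) linarith+
    have "\<bar>y - x\<bar> = \<bar>cf_rem a ?t y - cf_rem a ?t x\<bar> / \<bar>?D y * ?D x\<bar>"
      using in_cylinder_diff[OF in_cylinder_self all, of ?t] by (simp only: abs_mult abs_divide) simp
    also have "\<dots> \<le> 1 / real ?t"
    proof (rule frac_le)
      show "\<bar>cf_rem a ?t y - cf_rem a ?t x\<bar> \<le> 1"
        using all[of ?t] in_cylinder_self[of ?t]
        by (auto simp: in_cylinder_def abs_le_iff simp del: cf_rem.simps dest!: spec[of _ ?t])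
      show "real ?t \<le> \<bar>?D y * ?D x\<bar>" using DD by (intro order_trans[OF _ abs_ge_self]) simp
    qed simp_all
    finally show False using n by linarith
  qed
  then obtain t where t: "\<not> in_cylinder a t y" "\<And>s. s < t \<Longrightarrow> in_cylinder a s y"
    using exists_least_iff[of "\<lambda>t. \<not> in_cylinder a t y"] by blast
  then have "s < t" using in_cylinder_mono[OF assms(1), of t] by (meson not_le)
  then obtain t' where "t = Suc t'" by (cases t) auto
  then show thesis using that[of t'] t \<open>s < t\<close> by auto
qed

section \<open>Difference quotients at the last common cylinder\<close>

lemma cylinder_quotient:
  fixes z u :: real
  assumes "in_cylinder a t y" "y \<noteq> x"
  defines "z \<equiv> cf_rem a t y" and "u \<equiv> cf_rem a t x"
  shows "(question_mark y - question_mark x) / (y - x)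
      = (1/2) ^ quotient_sum a t * ((cf_den a t * z + cf_den a (Suc t)) * (cf_den a t * u + cf_den a (Suc t)))
        * ((question_mark z - question_mark u) / (z - u))"
proof -
  let ?K = "(cf_den a t * z + cf_den a (Suc t)) * (cf_den a t * u + cf_den a (Suc t))"
  have "y - x = (-1) ^ t * (z - u) / ?K"
    using in_cylinder_diff[OF in_cylinder_self assms(1)] by (simp only: z_def u_def)
  moreover have "question_mark y - question_mark x
    = (-1) ^ t * (1/2) ^ quotient_sum a t * (question_mark z - question_mark u)"
    using in_cylinder_question_mark_diff[OF in_cylinder_self assms(1)] by (simp only: z_def u_def)
  ultimately show ?thesis by (simp only:) simp
qed

lemma cylinder_den_sq:
  assumes "in_cylinder a t y"
  defines "K \<equiv> (cf_den a t * cf_rem a t y + cf_den a (Suc t)) * (cf_den a t * cf_rem a t x + cf_den a (Suc t))"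
  shows "(real (cf_den a (Suc t)))\<^sup>2 \<le> K" "K \<le> 4 * (real (cf_den a (Suc t)))\<^sup>2"
proof -
  note y = in_cylinder_den_bounds[OF assms(1)] and x = in_cylinder_den_bounds[OF in_cylinder_self, of t]
  show "(real (cf_den a (Suc t)))\<^sup>2 \<le> K"
    unfolding K_def power2_eq_square using x y by (intro mult_mono) linarith+
  have "K \<le> (2 * real (cf_den a (Suc t))) * (2 * real (cf_den a (Suc t)))"
    unfolding K_def using x y by (intro mult_mono) linarith+
  then show "K \<le> 4 * (real (cf_den a (Suc t)))\<^sup>2" by (simp add: power2_eq_square)
qed

text \<open>Of the constant 20, a factor 4 comes from the two denominators, each at most
  \<open>2 * cf_den a (Suc t)\<close>, and 5 from remainders in different cells.\<close>

lemma quotient_upper: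
  assumes "in_cylinder a t y" "\<not> in_cylinder a (Suc t) y" "y \<noteq> x"
  shows "\<bar>(question_mark y - question_mark x) / (y - x)\<bar>
    \<le> 20 * ((1/2) ^ quotient_sum a t * (real (cf_den a (Suc t)))\<^sup>2)"
proof -
  define z u where "z = cf_rem a t y" and "u = cf_rem a t x"
  define K where "K = (cf_den a t * z + cf_den a (Suc t)) * (cf_den a t * u + cf_den a (Suc t))"
  have K: "(real (cf_den a (Suc t)))\<^sup>2 \<le> K" "K \<le> 4 * (real (cf_den a (Suc t)))\<^sup>2"
    using cylinder_den_sq[OF assms(1)] by (simp_all only: K_def z_def u_def)
  have "0 \<le> (real (cf_den a (Suc t)))\<^sup>2" by simp
  then have K0: "0 \<le> K" using K by linarith
  have z: "z \<in> {0..1}" using assms(1) by (simp add: in_cylinder_def z_def)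
  have "\<bar>question_mark z - question_mark u\<bar> \<le> 5 * \<bar>z - u\<bar>"
    using question_mark_diff_across_cells[of "a (Suc t)" u z] not_in_cylinder_Suc[OF assms(1,2)]
      rem_cell[of t] digit_pos z by (simp add: z_def u_def)
  then have "\<bar>(question_mark z - question_mark u) / (z - u)\<bar> \<le> 5"
    by (cases "z = u") (auto simp: divide_le_eq)
  then have "K * \<bar>(question_mark z - question_mark u) / (z - u)\<bar> \<le> 4 * (real (cf_den a (Suc t)))\<^sup>2 * 5"
    using K K0 by (intro mult_mono) auto
  then have "(1/2) ^ quotient_sum a t * (K * \<bar>(question_mark z - question_mark u) / (z - u)\<bar>)
      \<le> (1/2) ^ quotient_sum a t * (4 * (real (cf_den a (Suc t)))\<^sup>2 * 5)"
    by (intro mult_left_mono) auto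
  moreover have "\<bar>(question_mark y - question_mark x) / (y - x)\<bar>
      = (1/2) ^ quotient_sum a t * (K * \<bar>(question_mark z - question_mark u) / (z - u)\<bar>)"
    unfolding cylinder_quotient[OF assms(1,3)] z_def[symmetric] u_def[symmetric] K_def[symmetric]
    using K0 by (simp add: abs_mult)
  ultimately show ?thesis by simp
qed

text \<open>The bounds on the next digit and remainder keep \<open>cf_rem a t x\<close> away from
  the ends of its cell, so a point just beyond an end cannot make the quotient small.\<close>

lemma quotient_lower:
  assumes "in_cylinder a t y" "\<not> in_cylinder a (Suc t) y" "y \<noteq> x"
    and "a (Suc t) \<le> 5" "1/6 \<le> cf_rem a (Suc t) x" "cf_rem a (Suc t) x \<le> 1/2"
  shows "(1/2) ^ 10 * ((1/2) ^ quotient_sum a t * (real (cf_den a (Suc t)))\<^sup>2)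
    \<le> (question_mark y - question_mark x) / (y - x)"
proof -
  define z u where "z = cf_rem a t y" and "u = cf_rem a t x"
  define K where "K = (cf_den a t * z + cf_den a (Suc t)) * (cf_den a t * u + cf_den a (Suc t))"
  have K: "(real (cf_den a (Suc t)))\<^sup>2 \<le> K"
    using cylinder_den_sq[OF assms(1)] by (simp_all only: K_def z_def u_def)
  have z: "z \<in> {0..1}" using assms(1) by (simp add: in_cylinder_def z_def)
  have u: "u \<in> {0<..<1}" using rem_mem by (simp add: u_def)
  note cell = not_in_cylinder_Suc[OF assms(1,2), folded z_def]
  have "z \<noteq> u" using rem_cell[of t] cell by (auto simp: u_def)
  have "u = 1 / (real (a (Suc t)) + cf_rem a (Suc t) x)" using u by (simp add: u_def)
  then have "(1/2) ^ 10 * \<bar>z - u\<bar> \<le> \<bar>question_mark z - question_mark u\<bar>"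
    using question_mark_diff_across_cells_ge[of "a (Suc t)" u "cf_rem a (Suc t) x" z] cell assms(4-6)
      digit_pos z by simp
  then have "(1/2) ^ 10 \<le> \<bar>question_mark z - question_mark u\<bar> / \<bar>z - u\<bar>"
    using \<open>z \<noteq> u\<close> by (simp add: le_divide_eq)
  \<comment> \<open>By monotonicity numerator and denominator have the same sign.\<close>
  also have "\<dots> = (question_mark z - question_mark u) / (z - u)"
  proof (cases "z < u")
    case True
    then have "question_mark z \<le> question_mark u" using question_mark_mono[of z u] z u by simp
    then show ?thesis using True minus_divide_divide[of "question_mark z - question_mark u" "z - u"] by simp
  next
    case False
    then have "question_mark u \<le> question_mark z" using question_mark_mono[of u z] z u by simp
    then show ?thesis using False by simp
  qed
  finally have slope: "(1/2) ^ 10 \<le> (question_mark z - question_mark u) / (z - u)" .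
  have "(real (cf_den a (Suc t)))\<^sup>2 * (1/2) ^ 10 \<le> K * ((question_mark z - question_mark u) / (z - u))"
    using K slope by (intro mult_mono) (auto intro: order_trans[OF _ K])
  then have "(1/2) ^ quotient_sum a t * ((real (cf_den a (Suc t)))\<^sup>2 * (1/2) ^ 10)
      \<le> (1/2) ^ quotient_sum a t * (K * ((question_mark z - question_mark u) / (z - u)))"
    by (intro mult_left_mono) auto
  moreover have "(question_mark y - question_mark x) / (y - x)
      = (1/2) ^ quotient_sum a t * (K * ((question_mark z - question_mark u) / (z - u)))"
    unfolding cylinder_quotient[OF assms(1,3)] z_def[symmetric] u_def[symmetric] K_def[symmetric]
    by simp
  ultimately show ?thesis by (simp add: mult_ac)
qed

text \<open>Points close to \<open>x\<close> share a deep cylinder with it, so their last common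
  index lies beyond any prescribed \<open>s\<close> and \<open>quotient_upper\<close> applies
  there.\<close>

lemma derivative_zero:
  assumes "(\<lambda>t. (1/2) ^ quotient_sum a t * (real (cf_den a (Suc t)))\<^sup>2) \<longlonglongrightarrow> 0"
  shows "(question_mark has_real_derivative 0) (at x)"
proof -
  have "((\<lambda>y. (question_mark y - question_mark x) / (y - x)) \<longlongrightarrow> 0) (at x)"
  proof (rule tendstoI)
    fix e :: real assume "0 < e"
    then have "eventually (\<lambda>t. (1/2) ^ quotient_sum a t * (real (cf_den a (Suc t)))\<^sup>2 < e / 20) sequentially"
      by (intro order_tendstoD(2)[OF assms]) simp
    then obtain s where s: "\<And>t. s \<le> t \<Longrightarrow> (1/2) ^ quotient_sum a t * (real (cf_den a (Suc t)))\<^sup>2 < e / 20"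
      by (auto simp: eventually_sequentially)
    have "eventually (\<lambda>y. y \<noteq> x) (at x)" by (simp add: eventually_at_filter)
    with eventually_in_cylinder[of s]
    show "eventually (\<lambda>y. dist ((question_mark y - question_mark x) / (y - x)) 0 < e) (at x)"
    proof eventually_elim
      case (elim y)
      obtain t where "s \<le> t" "in_cylinder a t y" "\<not> in_cylinder a (Suc t) y"
        using leaves_cylinder[OF elim] .
      then show ?case using quotient_upper[of t y] elim s[of t] by (simp add: dist_real_def)
    qed
  qed
  then show ?thesis by (simp add: has_field_derivative_iff)
qed

lemma derivative_infinity:
  assumes "filterlim (\<lambda>t. (1/2) ^ quotient_sum a t * (real (cf_den a (Suc t)))\<^sup>2) at_top sequentially"
    and "\<And>t. a (Suc t) \<le> 5" "\<And>t. 1/6 \<le> cf_rem a (Suc t) x" "\<And>t. cf_rem a (Suc t) x \<le> 1/2"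
  shows "filterlim (\<lambda>\<delta>. (question_mark (x + \<delta>) - question_mark x) / \<delta>) at_top (at 0)"
proof -
  have "filterlim (\<lambda>y. (question_mark y - question_mark x) / (y - x)) at_top (at x)"
    unfolding filterlim_at_top
  proof
    fix Z :: real
    have "eventually (\<lambda>t. 2 ^ 10 * Z \<le> (1/2) ^ quotient_sum a t * (real (cf_den a (Suc t)))\<^sup>2) sequentially"
      using assms(1) by (simp add: filterlim_at_top)
    then obtain s where s: "\<And>t. s \<le> t \<Longrightarrow> 2 ^ 10 * Z \<le> (1/2) ^ quotient_sum a t * (real (cf_den a (Suc t)))\<^sup>2"
      by (auto simp: eventually_sequentially)
    have "eventually (\<lambda>y. y \<noteq> x) (at x)" by (simp add: eventually_at_filter)
    with eventually_in_cylinder[of s]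
    show "eventually (\<lambda>y. Z \<le> (question_mark y - question_mark x) / (y - x)) (at x)"
    proof eventually_elim
      case (elim y)
      obtain t where t: "s \<le> t" "in_cylinder a t y" "\<not> in_cylinder a (Suc t) y"
        using leaves_cylinder[OF elim] .
      have "(1/2) ^ 10 * (2 ^ 10 * Z)
          \<le> (1/2) ^ 10 * ((1/2) ^ quotient_sum a t * (real (cf_den a (Suc t)))\<^sup>2)"
        using s[OF t(1)] by (intro mult_left_mono) auto
      also have "\<dots> \<le> (question_mark y - question_mark x) / (y - x)"
        using quotient_lower[of t y] t elim assms by blast
      finally show ?case by (simp add: power_divide)
    qed
  qed
  then show ?thesis
    by (subst (asm) filterlim_at_to_0) (simp add: add.commute)
qed

text \<open>For a remainder equal to \<open>x\<close> the Moebius relation is a quadratic equation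
  for \<open>x\<close>, with leading coefficient \<open>cf_den a n\<close>, nonzero because
  \<open>0 < n\<close>.\<close>

lemma quadratic_irrationalI:
  assumes "cf_rem a n x = x" "0 < n"
  shows "quadratic_irrational x"
proof -
  have "cf_den a n \<noteq> 0" using cf_den_Suc_pos[OF digit_pos, of "n - 1"] assms(2) by simp
  moreover have "of_int (int (cf_den a n)) * x\<^sup>2
      + of_int (int (cf_den a (Suc n)) - int (cf_num a n)) * x + of_int (- int (cf_num a (Suc n))) = 0"
    using in_cylinder_moebius[OF in_cylinder_self, of n] unfolding assms(1)
    by (simp add: algebra_simps power2_eq_square)
  ultimately show ?thesis
    using irrational unfolding quadratic_irrational_def by (metis of_nat_eq_0_iff)
qed

end

end


section \<open>Continued fraction expansions\<close>

lemma cf_convergent_mem: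
  assumes "\<forall>i\<ge>1. 0 < a i"
  shows "cf_convergent a t \<in> {0..1}"
  using assms
proof (induction t arbitrary: a)
  case 0
  then show ?case by simp
next
  case (Suc t)
  have "cf_convergent (\<lambda>i. a (Suc i)) t \<in> {0..1}" using Suc.prems by (intro Suc.IH) auto
  moreover have "1 \<le> real (a 1)" using Suc.prems by (simp add: Suc_le_eq)
  ultimately show ?case by (auto simp: divide_le_eq)
qed

lemma is_cf_expansion_digit_pos: "is_cf_expansion a x \<Longrightarrow> \<forall>i\<ge>1. 0 < a i"
  by (simp add: is_cf_expansion_def)

lemma is_cf_expansion_mem:
  assumes "is_cf_expansion a x"
  shows "x \<in> {0..1}"
proof -
  have "cf_convergent a t \<in> {0..1}" for t
    using cf_convergent_mem[OF is_cf_expansion_digit_pos[OF assms]] .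
  moreover have "cf_convergent a \<longlonglongrightarrow> x" using assms by (simp add: is_cf_expansion_def)
  ultimately show ?thesis by (rule closed_sequentially[rotated]) auto
qed

lemma is_cf_expansion_shift:
  assumes "is_cf_expansion a x" "x \<noteq> 0"
  shows "is_cf_expansion (\<lambda>i. a (Suc i)) (1 / x - real (a 1))"
proof -
  have "(\<lambda>t. cf_convergent a (Suc t)) \<longlonglongrightarrow> x"
    using assms LIMSEQ_Suc[of "cf_convergent a" x] by (simp only: is_cf_expansion_def)
  then have "(\<lambda>t. 1 / cf_convergent a (Suc t) - real (a 1)) \<longlonglongrightarrow> 1 / x - real (a 1)"
    by (intro tendsto_intros assms)
  then show ?thesis using assms by (simp add: is_cf_expansion_def)
qed

text \<open>Irrationality passes to the remainders and keeps them nonzero, so the shift can be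
  repeated.\<close>

lemma is_cf_expansion_cf_rem:
  assumes "is_cf_expansion a x" "x \<notin> \<rat>"
  shows "is_cf_expansion (\<lambda>i. a (i + t)) (cf_rem a t x) \<and> cf_rem a t x \<notin> \<rat>"
proof (induction t)
  case 0
  then show ?case using assms by simp
next
  case (Suc t)
  then have nz: "cf_rem a t x \<noteq> 0" by auto
  have "cf_rem a (Suc t) x \<notin> \<rat>"
  proof
    assume "cf_rem a (Suc t) x \<in> \<rat>"
    then have "1 / (cf_rem a (Suc t) x + of_nat (a (Suc t))) \<in> \<rat>"
      by (intro Rats_divide Rats_add Rats_1 Rats_of_nat)
    then show False using Suc by simp
  qed
  moreover have "is_cf_expansion (\<lambda>i. a (i + Suc t)) (cf_rem a (Suc t) x)"
    using is_cf_expansion_shift[of "\<lambda>i. a (i + t)" "cf_rem a t x"] Suc nz by simp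
  ultimately show ?case by blast
qed

lemma cf_rem_mem:
  assumes "is_cf_expansion a x" "x \<notin> \<rat>"
  shows "cf_rem a t x \<in> {0<..<1}"
proof -
  have *: "cf_rem a t x \<in> {0..1}" "cf_rem a t x \<notin> \<rat>"
    using is_cf_expansion_cf_rem[OF assms] is_cf_expansion_mem by blast+
  then have "cf_rem a t x \<noteq> 0" "cf_rem a t x \<noteq> 1" by auto
  then show ?thesis using * by auto
qed

text \<open>With digits at least 2 the maps \<open>y \<mapsto> 1 / (a + y)\<close> contract
  \<open>[0, 1]\<close> by the factor 1/2, which gives convergence for the words in 4 and 5.\<close>

lemma cf_convergent_diff:
  assumes "\<forall>i\<ge>1. 2 \<le> a i"
  shows "\<bar>cf_convergent a (Suc t) - cf_convergent a t\<bar> \<le> (1/2) ^ t"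
  using assms
proof (induction t arbitrary: a)
  case 0
  have "2 \<le> a 1" using 0 by simp
  then have "1 \<le> real (a 1)" by linarith
  then show ?case by (simp add: divide_le_eq)
next
  case (Suc t)
  let ?b = "\<lambda>i. a (Suc i)"
  let ?u = "real (a 1) + cf_convergent ?b (Suc t)" and ?v = "real (a 1) + cf_convergent ?b t"
  have pos: "\<forall>i\<ge>1. 0 < ?b i"
  proof (intro allI impI)
    fix i :: nat assume "1 \<le> i"
    then have "2 \<le> a (Suc i)" using Suc.prems by simp
    then show "0 < a (Suc i)" by simp
  qed
  have "2 \<le> a 1" using Suc.prems by simp
  then have "2 \<le> real (a 1)" by linarith
  then have uv: "2 \<le> ?u" "2 \<le> ?v"
    using cf_convergent_mem[OF pos, of t] cf_convergent_mem[OF pos, of "Suc t"]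
    by (simp_all del: cf_convergent.simps)
  then have prod: "2 * 1 \<le> ?u * ?v" by (intro mult_mono) auto
  have "cf_convergent a (Suc (Suc t)) - cf_convergent a (Suc t) = 1 / ?u - 1 / ?v"
    by (simp only: cf_convergent.simps(2)[of a])
  also have "\<dots> = (?v - ?u) / (?u * ?v)"
    using uv by (subst diff_frac_eq) auto
  finally have "\<bar>cf_convergent a (Suc (Suc t)) - cf_convergent a (Suc t)\<bar>
      = \<bar>cf_convergent ?b (Suc t) - cf_convergent ?b t\<bar> / (?u * ?v)"
    using prod by (simp del: cf_convergent.simps add: abs_divide abs_minus_commute)
  also have "\<dots> \<le> (1/2) ^ t / 2"
    using Suc.IH[of ?b] Suc.prems prod by (intro frac_le) auto
  finally show ?case by simp
qed

lemma cf_expansion_exists: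
  assumes "\<forall>i\<ge>1. 2 \<le> a i"
  obtains x where "is_cf_expansion a x"
proof -
  have "summable (\<lambda>t. cf_convergent a (Suc t) - cf_convergent a t)"
    by (rule summable_comparison_test'[where g = "\<lambda>t. (1/2) ^ t" and N = 0])
       (use cf_convergent_diff[OF assms] in \<open>auto simp del: cf_convergent.simps\<close>)
  then have "convergent (\<lambda>n. \<Sum>t<n. cf_convergent a (Suc t) - cf_convergent a t)"
    by (simp only: summable_iff_convergent)
  then have "convergent (cf_convergent a)"
    by (simp only: sum_lessThan_telescope cf_convergent.simps(1) diff_zero)
  moreover have "0 < a i" if "1 \<le> i" for i using assms that by (meson less_le_trans pos2)
  ultimately show thesis using that by (auto simp: is_cf_expansion_def convergent_def)
qed

section \<open>Vanishing derivative for large means\<close>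

lemma mean_liminf_gap:
  assumes "liminf (\<lambda>t. ereal (mean_partial_quotient a t)) > ereal k"
  obtains d where "0 < d"
    "eventually (\<lambda>t. d * real t \<le> real (quotient_sum a t) - k * real t) sequentially"
proof -
  obtain c where c: "ereal k < c" "c < liminf (\<lambda>t. ereal (mean_partial_quotient a t))"
    using dense[OF assms] by blast
  then obtain c' where c': "c = ereal c'" by (cases c) auto
  have "eventually (\<lambda>t. ereal c' < ereal (mean_partial_quotient a t)) sequentially"
    using less_LiminfD[OF c(2)[unfolded c']] .
  then have "eventually (\<lambda>t. (c' - k) * real t \<le> real (quotient_sum a t) - k * real t) sequentially"
    using eventually_gt_at_top[of 0]
  proof eventually_elim
    case (elim t)
    then show ?case by (simp add: mean_partial_quotient_eq less_divide_eq algebra_simps)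
  qed
  then show thesis using that[of "c' - k"] c c' by simp
qed

lemma derivative_zero_of_mean:
  assumes "is_cf_expansion a x" "x \<notin> \<rat>"
    and "liminf (\<lambda>t. ereal (mean_partial_quotient a t)) > ereal kappa2"
  shows "(question_mark has_real_derivative 0) (at x)"
proof (rule derivative_zero)
  show pos: "\<forall>i\<ge>1. 0 < a i" using is_cf_expansion_digit_pos[OF assms(1)] .
  show "cf_rem a t x \<in> {0<..<1}" for t using cf_rem_mem[OF assms(1,2)] .
  obtain d where d: "0 < d"
    "eventually (\<lambda>t. d * real t \<le> real (quotient_sum a t) - kappa2 * real t) sequentially"
    using mean_liminf_gap[OF assms(3)] .
  \<comment> \<open>A surplus of \<open>d\<close> per digit over \<open>kappa2\<close> gives the
    decay rate \<open>r\<close> per digit, below 1 because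
    \<open>L_const 5 < L_const 4\<close>.\<close>
  define r where "r = exp (2 * ((L_const 5 - L_const 4) * d))"
  have neg: "L_const 5 - L_const 4 < 0" using L_const_4_pos L_const_5_neg by simp
  then have "2 * ((L_const 5 - L_const 4) * d) < 0" using mult_neg_pos[OF neg d(1)] by linarith
  then have r: "0 < r" "r < 1" by (simp_all add: r_def)
  show "(\<lambda>t. (1/2) ^ quotient_sum a t * (real (cf_den a (Suc t)))\<^sup>2) \<longlonglongrightarrow> 0"
  proof (rule tendsto_sandwich[OF _ _ tendsto_const])
    show "(\<lambda>t. r ^ t) \<longlonglongrightarrow> 0" using r by (intro LIMSEQ_realpow_zero) auto
    show "eventually (\<lambda>t. (1/2) ^ quotient_sum a t * (real (cf_den a (Suc t)))\<^sup>2 \<le> r ^ t) sequentially"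
      using d(2)
    proof eventually_elim
      case (elim t)
      have "(L_const 5 - L_const 4) * (real (quotient_sum a t) - kappa2 * real t)
          \<le> (L_const 5 - L_const 4) * (d * real t)"
        using elim neg by (intro mult_left_mono_neg) auto
      then have "exp (2 * ((L_const 5 - L_const 4) * (real (quotient_sum a t) - kappa2 * real t)))
          \<le> exp (real t * (2 * ((L_const 5 - L_const 4) * d)))"
        by (simp only: exp_le_cancel_iff) argo
      also have "\<dots> = r ^ t" unfolding r_def by (rule exp_of_nat_mult)
      finally show ?case using cf_den_sq_le[OF pos, of t] by linarith
    qed
  qed auto
qed


section \<open>Periodic words in the partial quotients 4 and 5\<close>

lemma quotient_sum_periodic:
  assumes "\<And>i. a (Suc (i + n)) = a (Suc i)"
  shows "quotient_sum a (t + n) = quotient_sum a t + quotient_sum a n"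
proof (induction t)
  case 0
  then show ?case by (simp add: quotient_sum_0)
next
  case (Suc t)
  then show ?case using assms[of t] by (simp add: quotient_sum_Suc)
qed

text \<open>The deviation of the digit sum from \<open>l * t\<close> is periodic in
  \<open>t\<close>, hence bounded.\<close>

lemma mean_partial_quotient_periodic:
  assumes per: "\<And>i. a (Suc (i + n)) = a (Suc i)" and "0 < n"
  shows "mean_partial_quotient a \<longlonglongrightarrow> real (quotient_sum a n) / real n"
proof -
  define l where "l = real (quotient_sum a n) / real n"
  define e where "e t = real (quotient_sum a t) - l * real t" for t
  define B where "B = Max ((\<lambda>t. \<bar>e t\<bar>) ` {..<n})"
  have e_per: "e (t + n) = e t" for t
    using quotient_sum_periodic[of a, OF per, of t] \<open>0 < n\<close> by (simp add: e_def l_def field_simps)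
  have "\<bar>e t\<bar> \<le> B" for t
  proof (induction t rule: less_induct)
    case (less t)
    show ?case
    proof (cases "t < n")
      case True
      then show ?thesis by (simp add: B_def)
    next
      case False
      then show ?thesis using less.IH[of "t - n"] e_per[of "t - n"] \<open>0 < n\<close> by simp
    qed
  qed
  then have bound: "\<bar>e t / real t\<bar> \<le> B / real t" for t by (simp add: abs_divide divide_right_mono)
  have "(\<lambda>t. e t / real t) \<longlonglongrightarrow> 0"
  proof (rule Lim_null_comparison)
    show "eventually (\<lambda>t. norm (e t / real t) \<le> B / real t) sequentially" using bound by simp
    show "(\<lambda>t. B / real t) \<longlonglongrightarrow> 0" by (rule lim_const_over_n)
  qed
  then have "(\<lambda>t. l + e t / real t) \<longlonglongrightarrow> l + 0" by (intro tendsto_intros)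
  moreover have "eventually (\<lambda>t. l + e t / real t = mean_partial_quotient a t) sequentially"
    using eventually_gt_at_top[of 0]
    by eventually_elim (simp add: e_def mean_partial_quotient_eq field_simps)
  ultimately show ?thesis unfolding l_def using Lim_transform_eventually by fastforce
qed

text \<open>The period consists of \<open>m\<close> digits 4 followed by \<open>k\<close> digits 5;
  the shift \<open>i - 1\<close> lets it start at index 1.\<close>

definition block_word :: "nat \<Rightarrow> nat \<Rightarrow> nat \<Rightarrow> nat" where
  "block_word m k i = (if (i - 1) mod (m + k) < m then 4 else 5)"

context
  fixes m k :: nat
  assumes mk: "0 < m + k"
begin

lemma block_word_periodic: "block_word m k (Suc (i + n * (m + k))) = block_word m k (Suc i)"
  by (simp add: block_word_def)

lemma block_word_4: "i < m \<Longrightarrow> block_word m k (Suc (i + n * (m + k))) = 4"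
  unfolding block_word_periodic by (simp add: block_word_def)

lemma block_word_5: "i < k \<Longrightarrow> block_word m k (Suc (m + i + n * (m + k))) = 5"
  unfolding block_word_periodic by (simp add: block_word_def)

lemma block_word_bounds: "4 \<le> block_word m k i" "block_word m k i \<le> 5"
  by (simp_all add: block_word_def)

lemma block_word_pos: "\<forall>i\<ge>1. 0 < block_word m k i"
  by (simp add: block_word_def)

lemma quotient_sum_block_word: "quotient_sum (block_word m k) (m + k) = 4 * m + 5 * k"
proof -
  have "quotient_sum (block_word m k) i = 4 * i" if "i \<le> m" for i
    using that
  proof (induction i)
    case (Suc i)
    then show ?case using block_word_4[of i 0] by (simp add: quotient_sum_Suc)
  qed (simp add: quotient_sum_0)
  moreover have "quotient_sum (block_word m k) (m + i) = quotient_sum (block_word m k) m + 5 * i"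
    if "i \<le> k" for i
    using that
  proof (induction i)
    case (Suc i)
    then show ?case using block_word_5[of i 0] by (simp add: quotient_sum_Suc)
  qed simp
  ultimately show ?thesis by simp
qed

lemma quotient_sum_block_word_le:
  "quotient_sum (block_word m k) t \<le> (t div (m + k)) * (4 * m + 5 * k) + 5 * (m + k)"
proof -
  let ?P = "m + k"
  have mult: "quotient_sum (block_word m k) (s + n * ?P) = quotient_sum (block_word m k) s + n * (4 * m + 5 * k)"
    for s n
  proof (induction n)
    case (Suc n)
    have "quotient_sum (block_word m k) ((s + n * ?P) + ?P)
        = quotient_sum (block_word m k) (s + n * ?P) + (4 * m + 5 * k)"
      using quotient_sum_periodic[of "block_word m k" ?P "s + n * ?P"] block_word_periodic[of _ 1]
      by (simp add: quotient_sum_block_word)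
    then show ?case using Suc by (simp add: algebra_simps)
  qed simp
  have le5: "quotient_sum (block_word m k) s \<le> 5 * s" for s
  proof (induction s)
    case (Suc s)
    then show ?case using block_word_bounds(2)[of "Suc s"] by (simp add: quotient_sum_Suc)
  qed (simp add: quotient_sum_0)
  have "quotient_sum (block_word m k) (t mod ?P) \<le> 5 * ?P"
    using mod_less_divisor[OF mk, of t] by (intro order_trans[OF le5]) simp
  then show ?thesis using mult[of "t mod ?P" "t div ?P"] by (simp add: mod_div_mult_eq)
qed

text \<open>
  \<open>lam4 * q + q'\<close> and \<open>lam5 * q + q'\<close> are multiplied exactly by \<open>lam4\<close> and \<open>lam5\<close> along the two
  blocks; only the change of functional between blocks loses a constant factor.
\<close>

lemma block_word_den_growth:
  defines "f \<equiv> \<lambda>t. lam4 * cf_den (block_word m k) (Suc t) + cf_den (block_word m k) t"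
  shows "(lam4 / lam5) * (lam4 ^ m * lam5 ^ k) * f (n * (m + k)) \<le> f (Suc n * (m + k))"
proof -
  let ?b = "block_word m k" and ?P = "m + k"
  define g where "g t = lam5 * cf_den ?b (Suc t) + cf_den ?b t" for t
  have f4: "f (i + n * ?P) = lam4 ^ i * f (n * ?P)" if "i \<le> m" for i
    using that
  proof (induction i)
    case (Suc i)
    have "f (Suc (i + n * ?P)) = lam4 * f (i + n * ?P)"
      using block_word_4[of i n] Suc.prems lam4_mult by (simp add: f_def)
    then show ?case using Suc by simp
  qed simp
  have g5: "g (m + i + n * ?P) = lam5 ^ i * g (m + n * ?P)" if "i \<le> k" for i
    using that
  proof (induction i)
    case (Suc i)
    have "g (Suc (m + i + n * ?P)) = lam5 * g (m + i + n * ?P)"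
      using block_word_5[of i n] Suc.prems lam5_mult by (simp add: g_def)
    then show ?case using Suc by simp
  qed simp
  have l: "0 < lam4" "0 < lam5" "lam4 \<le> lam5" using lam4_bounds lam5_bounds by auto
  have fg: "f t \<le> g t" for t
    using l by (simp add: f_def g_def mult_right_mono)
  have gf: "(lam4 / lam5) * g t \<le> f t" for t
  proof -
    have "lam4 * cf_den ?b t \<le> lam5 * cf_den ?b t" using l by (intro mult_right_mono) auto
    then show ?thesis using l by (simp add: f_def g_def divide_le_eq algebra_simps)
  qed
  have "(lam4 / lam5) * (lam4 ^ m * lam5 ^ k) * f (n * ?P) = (lam4 / lam5) * (lam5 ^ k * f (m + n * ?P))"
    by (simp add: f4)
  also have "\<dots> \<le> (lam4 / lam5) * (lam5 ^ k * g (m + n * ?P))"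
    using l fg by (intro mult_left_mono) auto
  also have "\<dots> = (lam4 / lam5) * g (Suc n * ?P)"
    using g5[of k] by (simp add: add.commute)
  also have "\<dots> \<le> f (Suc n * ?P)" by (rule gf)
  finally show ?thesis .
qed

text \<open>At multiples of the period the functional \<open>f\<close> has gained a factor
  \<open>G\<close> per period, and it is nondecreasing in between. The constant 6 bounds
  \<open>lam4 + 1\<close>.\<close>

lemma block_word_den_ge:
  defines "G \<equiv> (lam4 / lam5) * (lam4 ^ m * lam5 ^ k)"
  shows "G ^ (t div (m + k)) \<le> 6 * real (cf_den (block_word m k) (Suc t))"
proof -
  let ?b = "block_word m k" and ?P = "m + k"
  define f where "f t = lam4 * cf_den ?b (Suc t) + cf_den ?b t" for t
  have l: "0 < lam4" "0 < lam5" using lam4_bounds lam5_bounds by auto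
  then have G: "0 < G" by (simp add: G_def)
  have "G ^ n \<le> f (n * ?P)" for n
  proof (induction n)
    case 0
    show ?case using lam4_bounds by (simp add: f_def)
  next
    case (Suc n)
    have "G ^ Suc n \<le> G * f (n * ?P)" using Suc G by simp
    also have "\<dots> \<le> f (Suc n * ?P)" using block_word_den_growth[of n] by (simp only: G_def f_def)
    finally show ?case .
  qed
  moreover have "f (t div ?P * ?P) \<le> f t"
  proof (rule lift_Suc_mono_le[of f])
    fix s
    have "lam4 * cf_den ?b (Suc s) \<le> lam4 * cf_den ?b (Suc (Suc s))"
      using l cf_den_mono_Suc[OF block_word_pos, of "Suc s"] by (intro mult_left_mono) (auto simp del: cf_den.simps)
    then show "f s \<le> f (Suc s)"
      using cf_den_mono_Suc[OF block_word_pos, of s] by (simp add: f_def del: cf_den.simps)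
  qed simp
  moreover have "f t \<le> 6 * real (cf_den ?b (Suc t))"
  proof -
    have "lam4 * real (cf_den ?b (Suc t)) \<le> 5 * real (cf_den ?b (Suc t))"
      using lam4_bounds by (intro mult_right_mono) auto
    then show ?thesis using cf_den_mono_Suc[OF block_word_pos, of t] by (simp add: f_def)
  qed
  ultimately show ?thesis by (meson order_trans)
qed

text \<open>The hypothesis says that the logarithmic gain of one period exceeds the loss
  \<open>ln lam5 - ln lam4\<close> from switching functionals. The quantity then grows by a factor
  \<open>r > 1\<close> per period.\<close>

lemma block_word_filterlim:
  assumes gain: "ln lam5 - ln lam4 < m * L_const 4 + k * L_const 5"
  shows "filterlim (\<lambda>t. (1/2) ^ quotient_sum (block_word m k) t
    * (real (cf_den (block_word m k) (Suc t)))\<^sup>2) at_top sequentially"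
proof -
  let ?b = "block_word m k" and ?P = "m + k" and ?S = "4 * m + 5 * k"
  define G where "G = (lam4 / lam5) * (lam4 ^ m * lam5 ^ k)"
  define r where "r = (1/2) ^ ?S * G\<^sup>2"
  \<comment> \<open>The power pays for the digits of an incomplete period, and 36 is the square of
    the constant in \<open>block_word_den_ge\<close>.\<close>
  define C :: real where "C = (1/2) ^ (5 * ?P) / 36"
  have l: "0 < lam4" "0 < lam5" using lam4_bounds lam5_bounds by auto
  then have G: "0 < G" by (simp add: G_def)
  have "ln r = 2 * (ln lam4 - ln lam5 + m * L_const 4 + k * L_const 5)"
    using l G by (simp add: r_def G_def L_const_4 L_const_5 ln_mult ln_div ln_realpow algebra_simps)
  then have "0 < ln r" using gain by simp
  moreover have "0 < r" using G by (simp add: r_def)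
  ultimately have "1 < r" by simp
  have "filterlim (\<lambda>t. r ^ (t div ?P)) at_top sequentially"
  proof (rule filterlim_compose[OF _ filterlim_at_top_div_const_nat[OF mk]])
    show "filterlim (\<lambda>n. r ^ n) at_top sequentially"
      using filterlim_realpow_sequentially_gt1[of r] \<open>1 < r\<close>
      by (intro filterlim_at_infinity_imp_filterlim_at_top) auto
  qed
  then have lim: "filterlim (\<lambda>t. C * r ^ (t div ?P)) at_top sequentially"
    by (intro filterlim_tendsto_pos_mult_at_top[OF tendsto_const]) (simp add: C_def)
  show ?thesis
  proof (rule filterlim_at_top_mono[OF lim], rule always_eventually, rule allI)
    fix t
    let ?n = "t div ?P"
    have "(G ^ ?n)\<^sup>2 \<le> (6 * real (cf_den ?b (Suc t)))\<^sup>2"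
      using G block_word_den_ge[of t] by (intro power_mono) (auto simp: G_def)
    then have den: "(G ^ ?n)\<^sup>2 / 36 \<le> (real (cf_den ?b (Suc t)))\<^sup>2"
      by (simp add: power_mult_distrib)
    have "(1/2) ^ (?n * ?S + 5 * ?P) \<le> (1/2::real) ^ quotient_sum ?b t"
      using quotient_sum_block_word_le[of t] by (intro power_decreasing) auto
    then have "(1/2) ^ (?n * ?S + 5 * ?P) * ((G ^ ?n)\<^sup>2 / 36)
        \<le> (1/2) ^ quotient_sum ?b t * (real (cf_den ?b (Suc t)))\<^sup>2"
      using den by (intro mult_mono) auto
    moreover have "C * r ^ ?n = (1/2) ^ (?n * ?S + 5 * ?P) * ((G ^ ?n)\<^sup>2 / 36)"
    proof -
      have "r ^ ?n = (1/2) ^ (?n * ?S) * (G ^ ?n)\<^sup>2"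
        unfolding r_def power_mult_distrib by (simp only: power_mult[symmetric] mult.commute)
      then show ?thesis unfolding C_def power_add by simp
    qed
    ultimately show "C * r ^ ?n \<le> (1/2) ^ quotient_sum ?b t * (real (cf_den ?b (Suc t)))\<^sup>2" by simp
  qed
qed

lemma block_word_expansion:
  assumes "is_cf_expansion (block_word m k) x"
  shows "1/6 \<le> cf_rem (block_word m k) t x" "cf_rem (block_word m k) t x \<le> 1/4"
    and "cf_rem (block_word m k) (m + k) x = x"
proof -
  let ?b = "block_word m k"
  have bounds: "1/6 \<le> y \<and> y \<le> 1/4"
    if exp: "is_cf_expansion (\<lambda>i. ?b (i + s)) y" for y s
  proof -
    have pos: "\<forall>i\<ge>1. 0 < ?b (Suc i + s)" by (simp add: block_word_def)
    have "cf_convergent (\<lambda>i. ?b (i + s)) (Suc t) \<in> {1/6..1/4}" for t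
    proof -
      have "4 \<le> ?b (1 + s)" "?b (1 + s) \<le> 5" by (rule block_word_bounds)+
      then have "4 \<le> real (?b (1 + s))" "real (?b (1 + s)) \<le> 5" by simp_all
      then have "1/6 \<le> 1 / (real (?b (1 + s)) + c) \<and> 1 / (real (?b (1 + s)) + c) \<le> 1/4"
        if "c \<in> {0..1}" for c
        using that by (intro conjI frac_le) auto
      then show ?thesis using cf_convergent_mem[OF pos, of t] by simp
    qed
    moreover have "(\<lambda>t. cf_convergent (\<lambda>i. ?b (i + s)) (Suc t)) \<longlonglongrightarrow> y"
      using exp LIMSEQ_Suc[of "cf_convergent (\<lambda>i. ?b (i + s))" y] by (simp only: is_cf_expansion_def)
    ultimately have "y \<in> {1/6..1/4}"
      by (rule closed_sequentially[OF closed_atLeastAtMost])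
    then show ?thesis by simp
  qed
  have exp: "is_cf_expansion (\<lambda>i. ?b (i + t)) (cf_rem ?b t x)" for t
  proof (induction t)
    case (Suc t)
    then have "cf_rem ?b t x \<noteq> 0" using bounds[OF Suc] by auto
    then show ?case using is_cf_expansion_shift[OF Suc] by simp
  qed (use assms in simp)
  show "1/6 \<le> cf_rem ?b t x" "cf_rem ?b t x \<le> 1/4" using bounds[OF exp] by blast+
  \<comment> \<open>The comparison is made one Gauss step later because periodicity holds for
    indices from 1 on, whereas equality of the shifted words as functions would also involve index
    0.\<close>
  have "is_cf_expansion (\<lambda>i. ?b (Suc i)) (cf_rem ?b 1 x)" using exp[of 1] by simp
  moreover have "is_cf_expansion (\<lambda>i. ?b (Suc i)) (cf_rem ?b (Suc (m + k)) x)"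
    using exp[of "Suc (m + k)"] block_word_periodic[of _ 1] by simp
  ultimately have "cf_rem ?b (Suc (m + k)) x = cf_rem ?b 1 x"
    unfolding is_cf_expansion_def by (meson LIMSEQ_unique)
  moreover have "?b (Suc (m + k)) = ?b 1" using block_word_periodic[of 0 1] by simp
  ultimately show "cf_rem ?b (m + k) x = x" by simp
qed

end

text \<open>Here \<theta> is the proportion of digits 5 at which the gain vanishes, and
  \<open>kappa2 = 4 + \<theta>\<close>. A rational proportion \<rho> slightly below it has positive
  gain; scaling both block lengths by a large \<open>N\<close> keeps the mean and lifts the gain
  above the fixed switching loss.\<close>

lemma block_word_parameters:
  assumes "0 < e"
  obtains m k :: nat where "0 < m" "0 < k" "kappa2 - e \<le> real (4 * m + 5 * k) / real (m + k)"
    "ln lam5 - ln lam4 < m * L_const 4 + k * L_const 5"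
proof -
  define h where "h = L_const 4 - L_const 5"
  define \<theta> where "\<theta> = L_const 4 / h"
  have h: "0 < h" and \<theta>: "0 < \<theta>" "\<theta> < 1"
    using L_const_4_pos L_const_5_neg by (auto simp: h_def \<theta>_def)
  have kap: "kappa2 = 4 + \<theta>"
    using h by (simp add: kappa2_def \<theta>_def h_def field_simps)
  \<comment> \<open>The maximum with 0 makes \<rho> positive; as also \<open>\<rho> < 1\<close>,
    both blocks are nonempty.\<close>
  obtain \<rho> where \<rho>: "\<rho> \<in> \<rat>" "max 0 (\<theta> - e) < \<rho>" "\<rho> < \<theta>"
    using Rats_dense_in_real[of "max 0 (\<theta> - e)" \<theta>] \<theta> assms by auto
  obtain b n :: nat where bn: "n \<noteq> 0" "\<bar>\<rho>\<bar> = real b / real n"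
    using Rats_abs_nat_div_natE[OF \<rho>(1)] by metis
  have \<rho>': "\<rho> = real b / real n" using bn \<rho> by simp
  have "real b / real n < 1" "0 < real b / real n" using \<rho> \<rho>' \<theta> by auto
  then have b: "0 < b" "b < n" using bn by (auto simp: divide_less_eq zero_less_divide_iff)
  define g where "g = real (n - b) * L_const 4 + real b * L_const 5"
  have g_eq: "g = real n * h * (\<theta> - \<rho>)"
    using b h bn by (simp add: g_def \<rho>' \<theta>_def of_nat_diff field_simps) (simp add: h_def algebra_simps)
  then have "0 < g" using bn h \<rho> by simp
  then obtain N :: nat where N: "ln lam5 - ln lam4 < real N * g"
    using reals_Archimedean3 by blast
  have "0 < N"
  proof (rule ccontr)
    assume "\<not> 0 < N"
    then show False using N lam4_bounds lam5_bounds by simp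
  qed
  show thesis
  proof (rule that[of "N * (n - b)" "N * b"])
    show "0 < N * (n - b)" "0 < N * b" using \<open>0 < N\<close> b by simp_all
    obtain c where n: "n = b + c" using b by (metis less_imp_add_positive)
    have sum: "N * (n - b) + N * b = N * n" by (simp add: n algebra_simps)
    have weighted: "4 * (N * (n - b)) + 5 * (N * b) = N * (4 * n + b)" by (simp add: n algebra_simps)
    have "real (4 * (N * (n - b)) + 5 * (N * b)) / real (N * (n - b) + N * b) = 4 + \<rho>"
      unfolding weighted sum using \<open>0 < N\<close> bn by (simp add: \<rho>' field_simps)
    then show "kappa2 - e \<le> real (4 * (N * (n - b)) + 5 * (N * b)) / real (N * (n - b) + N * b)"
      using \<rho> kap by simp
    show "ln lam5 - ln lam4 < real (N * (n - b)) * L_const 4 + real (N * b) * L_const 5"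
      using N by (simp add: g_def distrib_left mult.assoc)
  qed
qed

lemma quadratic_irrational_derivative_infinity:
  assumes "0 < e"
  shows "\<exists>(x::real) (a::nat \<Rightarrow> nat).
    0 < x \<and> x < 1 \<and> quadratic_irrational x \<and> is_cf_expansion a x \<and>
    (\<exists>l. mean_partial_quotient a \<longlonglongrightarrow> l \<and> l \<ge> kappa2 - e) \<and>
    filterlim (\<lambda>\<delta>. (question_mark (x + \<delta>) - question_mark x) / \<delta>) at_top (at 0)"
proof -
  obtain m k :: nat where mk: "0 < m" "0 < k"
    and mean: "kappa2 - e \<le> real (4 * m + 5 * k) / real (m + k)"
    and gain: "ln lam5 - ln lam4 < m * L_const 4 + k * L_const 5"
    using block_word_parameters[OF assms] .
  let ?b = "block_word m k"
  have P: "0 < m + k" using mk by simp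
  have "\<forall>i\<ge>1. 2 \<le> ?b i" by (simp add: block_word_def)
  then obtain x where x: "is_cf_expansion ?b x" by (rule cf_expansion_exists)
  note pos = block_word_pos[OF P]
  have rem: "1/6 \<le> cf_rem ?b t x" "cf_rem ?b t x \<le> 1/4" for t
    using block_word_expansion[OF P x] by auto
  have rem_mem: "cf_rem ?b t x \<in> {0<..<1}" for t using rem[of t] by simp
  have "quadratic_irrational x"
    using quadratic_irrationalI[OF pos rem_mem block_word_expansion(3)[OF P x] P] .
  moreover have "mean_partial_quotient ?b \<longlonglongrightarrow> real (4 * m + 5 * k) / real (m + k)"
    using mean_partial_quotient_periodic[of ?b "m + k"] block_word_periodic[OF P, of _ 1] P
      quotient_sum_block_word[OF P] by simp
  moreover have "filterlim (\<lambda>\<delta>. (question_mark (x + \<delta>) - question_mark x) / \<delta>) at_top (at 0)"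
  proof (rule derivative_infinity[OF pos rem_mem block_word_filterlim[OF P gain]])
    show "?b (Suc t) \<le> 5" for t using block_word_bounds[OF P] by blast
    show "1/6 \<le> cf_rem ?b (Suc t) x" for t using rem by blast
    show "cf_rem ?b (Suc t) x \<le> 1/2" for t using rem(2)[of "Suc t"] by linarith
  qed
  moreover have "0 < x" "x < 1" using rem_mem[of 0] by simp_all
  ultimately show ?thesis using x mean by blast
qed

theorem theorem2:
  shows "(\<forall>(x::real) (a::nat \<Rightarrow> nat).
            0 < x \<and> x < 1 \<and> x \<notin> \<rat> \<and> is_cf_expansion a x \<and>
            liminf (\<lambda>t. ereal (mean_partial_quotient a t)) > ereal kappa2
            \<longrightarrow> (question_mark has_real_derivative 0) (at x)) \<and>
         (\<forall>\<epsilon>::real. \<epsilon> > 0 \<longrightarrow>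
            (\<exists>(x::real) (a::nat \<Rightarrow> nat).
               0 < x \<and> x < 1 \<and> quadratic_irrational x \<and> is_cf_expansion a x \<and>
               (\<exists>l. mean_partial_quotient a \<longlonglongrightarrow> l \<and> l \<ge> kappa2 - \<epsilon>) \<and>
               filterlim (\<lambda>\<delta>. (question_mark (x + \<delta>) - question_mark x) / \<delta>) at_top (at 0)))"
  using derivative_zero_of_mean quadratic_irrational_derivative_infinity by blast

end
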